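(* Let $A$ and $C$ be matrices in $\mathbb{C}^{d\times d}$, with $C+kI$ invertible for all integers $k\ge0$. Then the matrix function $\mathcal{H}_6(A;C;x,y)$ satisfies the following differential formulae, where $r$ is a positive integer: (1) $\dfrac{\partial^r}{\partial x^r}\mathcal{H}_6(A;C;x,y)=(A)_{2r}\,\mathcal{H}_6(A+2rI;C+rI;x,y)\,(C)_r^{-1}$; (2) $\dfrac{\partial^r}{\partial y^r}\mathcal{H}_6(A;C;x,y)=(A)_r\,\mathcal{H}_6(A+rI;C+rI;x,y)\,(C)_r^{-1}$; (3) $\Big(x^2\dfrac{\partial}{\partial x}\Big)^r\big[x^{A+(r-1)I}\mathcal{H}_6(A;C;x^2,yx)\big]=x^{A+rI}(A)_r\,\mathcal{H}_6(A+rI;C;x^2,yx)$; (4) $\dfrac{\partial^r}{\partial x^r}\big[\mathcal{H}_6(A;C;x,xy)\,x^{C-I}\big]=(-1)^r\,\mathcal{H}_6(A;C-rI;x,xy)\,x^{C-(r+1)I}(I-C)_r$.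
   Context: $\mathcal{H}_6(A;C;x,y)=\sum_{m,n\ge0}(A)_{2m+n}(C)_{m+n}^{-1}\frac{x^m y^n}{m!\,n!}$. Matrix Pochhammer symbol: for $M\in\mathbb{C}^{d\times d}$, $(M)_0=I$, $(M)_n=M(M+I)\cdots(M+(n-1)I)$ for $n\ge1$; $(M)_n^{-1}$ is the inverse matrix of $(M)_n$. Matrix powers: $x^M=\exp(M\log x)$.
   Formalization: In (3) the bracket has x^A instead of x^{A+(r-1)I}, since the printed formula is false for r≥2 (d=1, A=C=1, y=0, r=2: 6x^4+… versus 2x^3+…); (4) also assumes C-rI+kI invertible for all k≥0, so that its right side is defined. Stated for first argument of modulus <1/4, powers off the cut. *)

theory Defs
  imports "HOL-Analysis.Analysis" "HOL-Complex_Analysis.Complex_Analysis"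
begin

text \<open>
  Square complex matrices are \<^typ>\<open>complex ^ 'd ^ 'd\<close>, with \<open>**\<close> as product and
  \<open>mat c\<close> as the scalar matrix \<open>c I\<close>. The type class operations \<open>*\<close>, \<open>1\<close> and \<open>^\<close>
  on this type are componentwise, hence not used.
\<close>

definition mscale :: "complex \<Rightarrow> complex ^ 'd ^ 'd \<Rightarrow> complex ^ 'd ^ 'd" where
  "mscale c M = (\<chi> i j. c * M $ i $ j)"

fun mpow :: "complex ^ 'd ^ 'd \<Rightarrow> nat \<Rightarrow> complex ^ 'd ^ 'd" where
  "mpow M 0 = mat 1"
| "mpow M (Suc n) = mpow M n ** M"

definition mexp :: "complex ^ 'd ^ 'd \<Rightarrow> complex ^ 'd ^ 'd" where
  "mexp M = (\<Sum>n. mscale (1 / fact n) (mpow M n))"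

text \<open>\<open>x\<^sup>M = exp (M log x)\<close>, with the principal branch of the logarithm.\<close>

definition mpowr :: "complex \<Rightarrow> complex ^ 'd ^ 'd \<Rightarrow> complex ^ 'd ^ 'd" where
  "mpowr x M = mexp (mscale (Ln x) M)"

fun mpochhammer :: "complex ^ 'd ^ 'd \<Rightarrow> nat \<Rightarrow> complex ^ 'd ^ 'd" where
  "mpochhammer M 0 = mat 1"
| "mpochhammer M (Suc n) = mpochhammer M n ** (M + mat (of_nat n))"

text \<open>
  Meaningful when all \<open>C + k I\<close>, \<open>k \<ge> 0\<close>, are invertible; the double series then converges
  absolutely for \<open>cmod x < 1/4\<close> and every \<open>y\<close>.
\<close>

definition H6 :: "complex ^ 'd ^ 'd \<Rightarrow> complex ^ 'd ^ 'd \<Rightarrow> complex \<Rightarrow> complex \<Rightarrow> complex ^ 'd ^ 'd" where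
  "H6 A C x y = (\<Sum>\<^sub>\<infinity>(m, n)\<in>UNIV.
     mscale (x ^ m * y ^ n / (fact m * fact n))
       (mpochhammer A (2 * m + n) ** matrix_inv (mpochhammer C (m + n))))"

text \<open>
  Complex differentiation of matrix-valued functions is entrywise. Since \<^const>\<open>deriv\<close> is
  total, \<open>mderiv\<close> is only meaningful where the entries are differentiable; on an open set on
  which \<open>mholomorphic_on\<close> holds, all its iterates are genuine derivatives.
\<close>

definition mholomorphic_on :: "(complex \<Rightarrow> complex ^ 'd ^ 'd) \<Rightarrow> complex set \<Rightarrow> bool" where
  "mholomorphic_on F S \<longleftrightarrow> (\<forall>i j. (\<lambda>t. F t $ i $ j) holomorphic_on S)"

definition mderiv :: "(complex \<Rightarrow> complex ^ 'd ^ 'd) \<Rightarrow> complex \<Rightarrow> complex ^ 'd ^ 'd" where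
  "mderiv F t = (\<chi> i j. deriv (\<lambda>s. F s $ i $ j) t)"

text \<open>The operator \<open>x\<^sup>2 d/dx\<close>.\<close>

definition x2_mderiv :: "(complex \<Rightarrow> complex ^ 'd ^ 'd) \<Rightarrow> complex \<Rightarrow> complex ^ 'd ^ 'd" where
  "x2_mderiv F t = mscale (t ^ 2) (mderiv F t)"

end

theory Submission
  imports Defs
begin

text \<open>
  Each of the four formulas follows from its case \<open>r = 1\<close>, proved for all admissible parameters and on an
  open set of arguments. The right-hand side is then an expression of the original form with shifted
  parameters, up to constant matrix factors, so it can be differentiated again
  (\<open>funpow_mderiv_eq\<close>). The constant factors collect to Pochhammer symbols.

  For \<open>r = 1\<close> the double series is differentiated term by term. Along each of the four curves
  \<open>t \<mapsto> (t, y)\<close>, \<open>(x, t)\<close>, \<open>(t\<^sup>2, y t)\<close> and \<open>(t, t y)\<close> it is a sum of monomials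
  \<open>t\<^bsup>w(m,n)\<^esup>\<close> with constant matrix coefficients, and \<open>has_mderiv_monomial_family\<close> covers all of them at once.
  The formulas now reduce to identities between coefficients, all of which come from splitting off
  the first or the last factor of a Pochhammer symbol:

  \<^item> in the first two, the index of the differentiated monomial is shifted, and
    \<open>(A)\<^sub>k\<^sub>+\<^sub>1 = A (A + I)\<^sub>k\<close> raises both parameters (\<open>hcoeff_Suc_fst\<close>, \<open>hcoeff_Suc_snd\<close>);
  \<^item> in the last two, the accompanying power \<open>t\<^sup>A\<close> or \<open>t\<^bsup>C-I\<^esup>\<close> makes differentiation multiply the term
    of degree \<open>k\<close> in \<open>t\<close> by \<open>A + k I\<close> or \<open>C - I + k I\<close>. The first raises the parameter of \<open>(A)\<^sub>k\<close>
    (\<open>hcoeff_raise\<close>), the second lowers that of the inverse of \<open>(C)\<^sub>k\<close> (\<open>hcoeff_lower\<close>).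

  The matrices \<open>A\<close> and \<open>C\<close> need not commute. Every identity therefore exchanges only factors built from \<open>A\<close>,
  on the left of the series, or only factors built from \<open>C\<close>, on its right.

  Termwise differentiation requires absolute convergence (\<open>hcoeff_summable\<close>). Up to factors \<open>q\<^sup>k\<close> with \<open>q > 1\<close>
  arbitrarily close to \<open>1\<close>, the norms of \<open>(A)\<^sub>k\<close> and of the inverse of \<open>(C)\<^sub>k\<close> grow like \<open>k!\<close> and \<open>1 / k!\<close>.
  The coefficients thus behave like \<open>(2m+n)! / ((m+n)! m! n!)\<close>, which is at most \<open>4\<^sup>m 2\<^sup>n / n!\<close>.
\<close>

section \<open>Matrices and scalar multiples\<close>

lemma matrix_add_rdistrib: "(A + B) ** C = A ** C + B ** (C :: complex^'n^'m)"
  by (vector matrix_matrix_mult_def sum.distrib[symmetric] field_simps)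

lemma norm_matrix_mult_le:
  fixes A :: "complex^'m^'l" and B :: "complex^'n^'m"
  shows "norm (A ** B) \<le> norm A * norm B"
proof -
  have row: "norm ((A ** B) $ i) \<le> norm (A $ i) * norm B" for i
  proof -
    have "(A ** B) $ i = (\<Sum>l\<in>UNIV. A $ i $ l *s B $ l)"
      by (simp add: vec_eq_iff matrix_matrix_mult_def)
    then have "norm ((A ** B) $ i) \<le> (\<Sum>l\<in>UNIV. norm (A $ i $ l *s B $ l))"
      by (simp add: norm_sum)
    also have "\<dots> = (\<Sum>l\<in>UNIV. cmod (A $ i $ l) * norm (B $ l))"
      by (simp add: norm_vec_def L2_set_right_distrib norm_mult)
    also have "\<dots> \<le> norm (A $ i) * norm B"
      using L2_set_mult_ineq[of "\<lambda>l. cmod (A $ i $ l)" "\<lambda>l. norm (B $ l)" UNIV]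
      by (simp add: norm_vec_def)
    finally show ?thesis .
  qed
  have "norm (A ** B) = L2_set (\<lambda>i. norm ((A ** B) $ i)) UNIV"
    by (simp add: norm_vec_def)
  also have "\<dots> \<le> L2_set (\<lambda>i. norm (A $ i) * norm B) UNIV"
    by (intro L2_set_mono row) auto
  also have "\<dots> = norm A * norm B"
    by (simp add: norm_vec_def[of A] L2_set_left_distrib)
  finally show ?thesis .
qed

lemma mscale_nth [simp]: "mscale c M $ i $ j = c * M $ i $ j"
  by (simp add: mscale_def)

lemma mscale_mult_left: "mscale c A ** B = mscale c (A ** B)"
  by (simp add: vec_eq_iff matrix_matrix_mult_def sum_distrib_left mult.assoc)

lemma mscale_mult_right: "A ** mscale c B = mscale c (A ** B)"
  by (simp add: vec_eq_iff matrix_matrix_mult_def sum_distrib_left algebra_simps)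

lemma mscale_mscale: "mscale a (mscale b M) = mscale (a * b) M"
  by (simp add: vec_eq_iff)

lemma mscale_one [simp]: "mscale 1 M = M"
  by (simp add: vec_eq_iff)

lemma mscale_zero [simp]: "mscale 0 M = 0" "mscale c 0 = 0"
  by (simp_all add: vec_eq_iff)

lemma mscale_add_right: "mscale a (M + N) = mscale a M + mscale a N"
  by (simp add: vec_eq_iff algebra_simps)

lemma norm_mscale: "norm (mscale c M) = cmod c * norm M"
  by (simp add: norm_vec_def L2_set_right_distrib norm_mult)

lemma mat_eq_mscale: "mat c = mscale c (mat 1)"
  by (simp add: vec_eq_iff mat_def)

lemma mult_mat: "A ** mat c = mscale c A"
  by (subst mat_eq_mscale) (simp add: mscale_mult_right)

lemma mat_mult: "mat c ** A = mscale c A"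
  by (subst mat_eq_mscale) (simp add: mscale_mult_left)

lemma mat_add: "mat a + mat b = (mat (a + b) :: complex^'d^'d)"
  by (auto simp: vec_eq_iff mat_def)

lemma add_mat_mat: "A + mat a + mat b = A + (mat (a + b) :: complex^'d^'d)"
  by (simp only: add.assoc mat_add)

text \<open>
  Submultiplicativity of the Euclidean norm turns multiplication by a fixed matrix into a bounded linear
  map, so constant factors can be moved through infinite sums.
\<close>

lemma bounded_bilinear_matrix_mult:
  "bounded_bilinear ((**) :: complex^'m^'l \<Rightarrow> complex^'n^'m \<Rightarrow> complex^'n^'l)"
proof
  show "\<exists>K. \<forall>(a::complex^'m^'l) (b::complex^'n^'m). norm (a ** b) \<le> norm a * norm b * K"
    by (rule exI[of _ 1]) (simp add: norm_matrix_mult_le)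
qed (simp_all add: matrix_add_rdistrib matrix_add_ldistrib,
    simp_all add: vec_eq_iff matrix_matrix_mult_def scaleR_sum_right)

lemma bounded_linear_mult_left: "bounded_linear (\<lambda>X. (B :: complex^'m^'l) ** (X :: complex^'n^'m))"
  by (rule bounded_bilinear.bounded_linear_right[OF bounded_bilinear_matrix_mult])

lemma bounded_linear_mult_right: "bounded_linear (\<lambda>X. (X :: complex^'m^'l) ** (B :: complex^'n^'m))"
  by (rule bounded_bilinear.bounded_linear_left[OF bounded_bilinear_matrix_mult])

lemma bounded_linear_mscale: "bounded_linear (mscale c)"
  by (rule bounded_linear_intro[where K = "cmod c"])
    (simp_all add: mscale_add_right norm_mscale vec_eq_iff mult.commute)

lemma bounded_linear_entry: "bounded_linear (\<lambda>X :: complex^'n^'m. X $ i $ j)"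
  by (rule bounded_linear_compose[OF bounded_linear_vec_nth bounded_linear_vec_nth])

lemma has_sum_entries:
  fixes f :: "'p \<Rightarrow> complex^'n^'m"
  assumes "\<And>i j. ((\<lambda>p. f p $ i $ j) has_sum S $ i $ j) X"
  shows "(f has_sum S) X"
  unfolding has_sum_def
proof (intro vec_tendstoI)
  fix i j
  show "((\<lambda>F. sum f F $ i $ j) \<longlongrightarrow> S $ i $ j) (finite_subsets_at_top X)"
    using assms[of i j] by (simp add: has_sum_def)
qed

lemma entry_infsum:
  fixes f :: "'p \<Rightarrow> complex^'n^'m"
  assumes "f summable_on X"
  shows "((\<lambda>p. f p $ i $ j) has_sum infsum f X $ i $ j) X"
  by (rule has_sum_bounded_linear[OF bounded_linear_entry has_sum_infsum[OF assms]])

text \<open>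
  For square matrices over a field a right inverse is two-sided, so one equation identifies the value
  chosen by \<^const>\<open>matrix_inv\<close>.
\<close>

lemma matrix_inv_unique_left:
  fixes A B :: "complex^'d^'d"
  assumes "A ** B = mat 1"
  shows "matrix_inv A = B"
proof -
  have BA: "B ** A = mat 1" using assms matrix_left_right_inverse by blast
  then have "\<exists>A'. A ** A' = mat 1 \<and> A' ** A = mat 1" using assms by blast
  then have "A ** matrix_inv A = mat 1"
    unfolding matrix_inv_def by (rule someI2_ex) simp
  then show ?thesis
    by (metis BA matrix_mul_assoc matrix_mul_lid matrix_mul_rid)
qed

lemma matrix_inv_cancel:
  fixes A :: "complex^'d^'d"
  assumes "invertible A"
  shows "A ** matrix_inv A = mat 1" "matrix_inv A ** A = mat 1"
  using assms matrix_inv_unique_left[of A] matrix_left_right_inverse unfolding invertible_def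
  by metis+

lemma matrix_inv_mult:
  fixes A B :: "complex^'d^'d"
  assumes "invertible A" "invertible B"
  shows "matrix_inv (A ** B) = matrix_inv B ** matrix_inv A"
  by (rule matrix_inv_unique_left)
    (metis assms matrix_inv_cancel matrix_mul_assoc matrix_mul_lid)

lemma matrix_inv_one: "matrix_inv (mat 1) = (mat 1 :: complex^'d^'d)"
  by (rule matrix_inv_unique_left) simp

lemma matrix_inv_commute:
  fixes X M :: "complex^'d^'d"
  assumes "X ** M = M ** X" "invertible M"
  shows "X ** matrix_inv M = matrix_inv M ** X"
proof -
  have "matrix_inv M ** (X ** M) ** matrix_inv M = matrix_inv M ** (M ** X) ** matrix_inv M"
    by (simp only: assms(1))
  then show ?thesis
    using matrix_inv_cancel[OF assms(2)]
    by (metis matrix_mul_assoc matrix_mul_lid matrix_mul_rid)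
qed

section \<open>The matrix Pochhammer symbol\<close>

lemma commute_add_mat:
  fixes A B :: "complex^'d^'d"
  assumes "A ** B = B ** A"
  shows "A ** (B + mat c) = (B + mat c) ** A"
  by (simp add: assms matrix_add_ldistrib matrix_add_rdistrib mult_mat mat_mult)

text \<open>
  Every exchange of factors below is between expressions built from a single matrix by scalar shifts,
  products, inverses and power series. It suffices that each of these constructions preserves
  commutation.
\<close>

lemma commute_mult:
  fixes A B C :: "complex^'d^'d"
  assumes "A ** B = B ** A" "A ** C = C ** A"
  shows "A ** (B ** C) = (B ** C) ** A"
  by (metis assms matrix_mul_assoc)

lemma commute_mpochhammer:
  assumes "X ** M = M ** X"
  shows "X ** mpochhammer M n = mpochhammer M n ** X"
proof (induction n)
  case (Suc n)
  show ?case
    using commute_mult[OF Suc commute_add_mat[OF assms]] by simp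
qed simp

lemma mpochhammer_add:
  "mpochhammer M (j + k) = mpochhammer M j ** mpochhammer (M + mat (of_nat j)) k"
  by (induction k) (simp_all add: matrix_mul_assoc add.assoc mat_add)

lemma mpochhammer_Suc_left: "mpochhammer M (Suc k) = M ** mpochhammer (M + mat 1) k"
  using mpochhammer_add[of M 1 k] by simp

text \<open>
  Both sides are the product \<open>(M)\<^sub>k\<^sub>+\<^sub>1\<close>, with the first or the last
  factor split off. Moving a factor from one end to the other is what shifts the parameters of the
  series.
\<close>

lemma mpochhammer_shift:
  "M ** mpochhammer (M + mat 1) k = mpochhammer M k ** (M + mat (of_nat k))"
  using mpochhammer_add[of M 1 k] by simp

lemma invertible_mpochhammer:
  assumes "\<And>k::nat. invertible (C + mat (of_nat k))"
  shows "invertible (mpochhammer C n)"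
proof (induction n)
  case 0
  show ?case by (auto simp: invertible_def intro: exI[of _ "mat 1"])
next
  case (Suc n)
  then show ?case using assms by (simp add: invertible_mult)
qed

lemma invertible_shift:
  fixes C :: "complex^'d^'d"
  assumes "\<And>k::nat. invertible (C + mat (of_nat k))"
  shows "invertible (C + mat (of_nat j) + mat (of_nat k))"
  using assms[of "j + k"] by (simp add: mat_add add.assoc)

lemma matrix_inv_mpochhammer_Suc:
  fixes C :: "complex^'d^'d"
  assumes "\<And>k::nat. invertible (C + mat (of_nat k))"
  shows "matrix_inv (mpochhammer C (Suc k)) = matrix_inv (mpochhammer (C + mat 1) k) ** matrix_inv C"
proof -
  have "invertible C" using assms[of 0] by simp
  moreover have "invertible (mpochhammer (C + mat 1) k)"
    by (rule invertible_mpochhammer) (use invertible_shift[OF assms, of 1] in simp)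
  ultimately show ?thesis
    unfolding mpochhammer_Suc_left by (rule matrix_inv_mult)
qed

section \<open>Entrywise complex derivatives\<close>

text \<open>
  Unlike the total function \<^const>\<open>mderiv\<close>, this relation asserts that the entries are
  differentiable, so it obeys the product and chain rules without side conditions.
\<close>

definition has_mderiv ::
  "(complex \<Rightarrow> complex^'d^'d) \<Rightarrow> complex^'d^'d \<Rightarrow> complex \<Rightarrow> bool" where
  "has_mderiv F D t \<longleftrightarrow> (\<forall>i j. ((\<lambda>s. F s $ i $ j) has_field_derivative D $ i $ j) (at t))"

lemma mderiv_eqI: "has_mderiv F D t \<Longrightarrow> mderiv F t = D"
  by (simp add: has_mderiv_def mderiv_def vec_eq_iff DERIV_imp_deriv)

lemma mholomorphic_onI:
  assumes "open S" "\<And>t. t \<in> S \<Longrightarrow> has_mderiv F (D t) t"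
  shows "mholomorphic_on F S"
  unfolding mholomorphic_on_def holomorphic_on_open[OF assms(1)]
  using assms(2) unfolding has_mderiv_def by blast

lemma has_mderiv_const: "has_mderiv (\<lambda>s. M) 0 t"
  by (simp add: has_mderiv_def)

lemma has_mderiv_mult:
  assumes "has_mderiv F D t" "has_mderiv G E t"
  shows "has_mderiv (\<lambda>s. F s ** G s) (D ** G t + F t ** E) t"
  unfolding has_mderiv_def
proof (intro allI)
  fix i j
  have "((\<lambda>s. \<Sum>k\<in>UNIV. F s $ i $ k * G s $ k $ j) has_field_derivative
      (\<Sum>k\<in>UNIV. D $ i $ k * G t $ k $ j + F t $ i $ k * E $ k $ j)) (at t)"
  proof (rule DERIV_sum)
    fix k
    have "((\<lambda>s. F s $ i $ k) has_field_derivative D $ i $ k) (at t)"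
      "((\<lambda>s. G s $ k $ j) has_field_derivative E $ k $ j) (at t)"
      using assms by (simp_all only: has_mderiv_def)
    from DERIV_mult[OF this]
    show "((\<lambda>s. F s $ i $ k * G s $ k $ j) has_field_derivative
        (D $ i $ k * G t $ k $ j + F t $ i $ k * E $ k $ j)) (at t)"
      by (simp only: mult.commute[of "E $ k $ j"])
  qed
  then show "((\<lambda>s. (F s ** G s) $ i $ j) has_field_derivative
      (D ** G t + F t ** E) $ i $ j) (at t)"
    by (simp add: matrix_matrix_mult_def sum.distrib)
qed

lemma has_mderiv_mult_const_left:
  "has_mderiv F D t \<Longrightarrow> has_mderiv (\<lambda>s. M ** F s) (M ** D) t"
  using has_mderiv_mult[OF has_mderiv_const[of M], of F D t] by simp

lemma has_mderiv_mult_const_right: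
  "has_mderiv F D t \<Longrightarrow> has_mderiv (\<lambda>s. F s ** M) (D ** M) t"
  using has_mderiv_mult[OF _ has_mderiv_const[of M], of F D t] by simp

lemma has_mderiv_mscale:
  assumes "(f has_field_derivative f') (at t)" "has_mderiv F D t"
  shows "has_mderiv (\<lambda>s. mscale (f s) (F s)) (mscale f' (F t) + mscale (f t) D) t"
  unfolding has_mderiv_def
proof (intro allI)
  fix i j
  have "((\<lambda>s. F s $ i $ j) has_field_derivative D $ i $ j) (at t)"
    using assms(2) by (simp add: has_mderiv_def)
  from DERIV_mult[OF assms(1) this]
  show "((\<lambda>s. mscale (f s) (F s) $ i $ j) has_field_derivative
      (mscale f' (F t) + mscale (f t) D) $ i $ j) (at t)"
    by (simp add: mult.commute)
qed

lemma has_mderiv_cmult: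
  "has_mderiv F D t \<Longrightarrow> has_mderiv (\<lambda>s. mscale c (F s)) (mscale c D) t"
  using has_mderiv_mscale[of "\<lambda>_. c" 0 t F D] by simp

lemma has_mderiv_compose:
  assumes "has_mderiv F D (g t)" "(g has_field_derivative g') (at t)"
  shows "has_mderiv (\<lambda>s. F (g s)) (mscale g' D) t"
  unfolding has_mderiv_def
proof (intro allI)
  fix i j
  have "((\<lambda>s. F s $ i $ j) has_field_derivative D $ i $ j) (at (g t))"
    using assms(1) by (simp add: has_mderiv_def)
  from DERIV_chain2[OF this assms(2)]
  show "((\<lambda>s. F (g s) $ i $ j) has_field_derivative mscale g' D $ i $ j) (at t)"
    by (simp add: mult.commute)
qed

lemma has_mderiv_transform_open:
  assumes "has_mderiv F D t" "open S" "t \<in> S" "\<And>s. s \<in> S \<Longrightarrow> F s = G s"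
  shows "has_mderiv G D t"
  unfolding has_mderiv_def
proof (intro allI)
  fix i j
  have "((\<lambda>s. F s $ i $ j) has_field_derivative D $ i $ j) (at t)"
    using assms(1) by (simp add: has_mderiv_def)
  then show "((\<lambda>s. G s $ i $ j) has_field_derivative D $ i $ j) (at t)"
    by (rule has_field_derivative_transform_within_open[OF _ assms(2,3)]) (simp add: assms(4))
qed

lemma has_mderiv_zero_constant:
  assumes "\<And>t. has_mderiv F 0 t"
  shows "F t = F 0"
proof -
  have "F t $ i $ j = F 0 $ i $ j" for i j
  proof -
    have "((\<lambda>s. F s $ i $ j) has_field_derivative 0) (at x within UNIV)" for x
      using assms[of x] by (simp add: has_mderiv_def)
    from has_field_derivative_zero_constant[OF convex_UNIV this] show ?thesis by auto
  qed
  then show ?thesis by (simp add: vec_eq_iff)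
qed

section \<open>Termwise differentiation of sums of monomials\<close>

text \<open>
  An index shift: differentiation annihilates the terms outside the range of \<open>h\<close>, and the
  others are renumbered by \<open>h\<close>.
\<close>

lemma has_sum_reindex_support:
  assumes "(f has_sum S) UNIV" "inj h" "\<And>p. p \<notin> range h \<Longrightarrow> f p = 0"
  shows "((\<lambda>p. f (h p)) has_sum S) UNIV"
proof -
  have "(f has_sum S) (range h)"
    using assms(1,3) by (subst has_sum_cong_neutral[where T = UNIV]) auto
  then show ?thesis using assms(2) by (simp add: has_sum_reindex o_def)
qed

text \<open>
  The finite partial sums are polynomials in \<open>s\<close> and converge uniformly on a closed disc about
  \<open>z\<close> by the Weierstrass test with majorant \<open>\<rho> ^ w p * cmod (d p)\<close>; locally uniform limits of
  holomorphic functions may be differentiated termwise.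

  The exponent \<open>w p\<close> is an arbitrary function of an index \<open>p\<close> of any type. The power series of the
  exponential (\<open>w n = n\<close>) and the double series of \<^const>\<open>H6\<close> along the four curves of the theorem
  (\<open>w (m, n) = m\<close>, \<open>n\<close>, \<open>2 m + n\<close> and \<open>m + n\<close>) are then instances of one statement, and no double sum
  has to be rearranged into a power series.
\<close>

lemma monomial_family_termwise_derivative:
  fixes d :: "'p \<Rightarrow> complex"
  assumes summable: "\<And>\<rho>. 0 \<le> \<rho> \<Longrightarrow> \<rho> < R \<Longrightarrow> (\<lambda>p. \<rho> ^ w p * cmod (d p)) summable_on UNIV"
    and z: "cmod z < R"
  obtains D where "((\<lambda>p. of_nat (w p) * z ^ (w p - 1) * d p) has_sum D) UNIV"
    and "((\<lambda>s. \<Sum>\<^sub>\<infinity>p. s ^ w p * d p) has_field_derivative D) (at z)"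
proof -
  obtain \<rho> where \<rho>: "cmod z < \<rho>" "\<rho> < R" using dense[OF z] by blast
  \<comment> \<open>a closed disc about \<open>z\<close> on which \<open>cmod s \<le> \<rho>\<close>, with \<open>\<rho>\<close> still below \<open>R\<close>\<close>
  define r where "r = \<rho> - cmod z"
  have r: "r > 0" using \<rho> by (simp add: r_def)
  have bound: "cmod (s ^ w p * d p) \<le> \<rho> ^ w p * cmod (d p)" if "s \<in> cball z r" for s p
  proof -
    have "cmod s \<le> cmod z + dist z s"
      using norm_triangle_sub[of s z] by (simp add: dist_norm norm_minus_commute)
    then have "cmod s \<le> \<rho>" using that by (simp add: r_def)
    then show ?thesis by (simp add: norm_mult norm_power mult_right_mono power_mono)
  qed
  have ulim: "uniform_limit (cball z r) (\<lambda>X s. \<Sum>p\<in>X. s ^ w p * d p)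
      (\<lambda>s. \<Sum>\<^sub>\<infinity>p. s ^ w p * d p) (finite_subsets_at_top UNIV)"
    using \<rho> order_trans[OF norm_ge_zero less_imp_le[OF \<rho>(1)]]
    by (intro Weierstrass_m_test_general[where M = "\<lambda>p. \<rho> ^ w p * cmod (d p)"] bound summable)
      auto
  have "\<forall>\<^sub>F X in finite_subsets_at_top UNIV.
      continuous_on (cball z r) (\<lambda>s. \<Sum>p\<in>X. s ^ w p * d p) \<and>
      (\<forall>s\<in>ball z r. ((\<lambda>s. \<Sum>p\<in>X. s ^ w p * d p) has_field_derivative
        (\<Sum>p\<in>X. of_nat (w p) * s ^ (w p - 1) * d p)) (at s))"
  proof (intro always_eventually allI conjI ballI)
    fix X :: "'p set" and s
    show "continuous_on (cball z r) (\<lambda>s. \<Sum>p\<in>X. s ^ w p * d p)"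
      by (intro continuous_intros)
    show "((\<lambda>s. \<Sum>p\<in>X. s ^ w p * d p) has_field_derivative
        (\<Sum>p\<in>X. of_nat (w p) * s ^ (w p - 1) * d p)) (at s)"
      by (rule DERIV_sum) (auto intro!: derivative_eq_intros)
  qed
  from has_complex_derivative_uniform_limit[OF this ulim _ r]
  obtain g' where g': "\<And>s. s \<in> ball z r \<Longrightarrow>
      ((\<lambda>s. \<Sum>\<^sub>\<infinity>p. s ^ w p * d p) has_field_derivative g' s) (at s) \<and>
      ((\<lambda>X. \<Sum>p\<in>X. of_nat (w p) * s ^ (w p - 1) * d p) \<longlongrightarrow> g' s) (finite_subsets_at_top UNIV)"
    by auto
  show thesis
    using g'[of z] r by (intro that[of "g' z"]) (auto simp: has_sum_def)
qed

lemma has_mderiv_monomial_family: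
  fixes M :: "'p \<Rightarrow> complex^'d^'d"
  assumes summable: "\<And>\<rho>. 0 \<le> \<rho> \<Longrightarrow> \<rho> < R \<Longrightarrow> (\<lambda>p. \<rho> ^ w p * norm (M p)) summable_on UNIV"
    and z: "cmod z < R"
  obtains D where "((\<lambda>p. mscale (of_nat (w p) * z ^ (w p - 1)) (M p)) has_sum D) UNIV"
    and "has_mderiv (\<lambda>s. \<Sum>\<^sub>\<infinity>p. mscale (s ^ w p) (M p)) D z"
proof -
  have entry_le: "cmod (N $ i $ j) \<le> norm N" for N :: "complex^'d^'d" and i j
    using order_trans[OF Finite_Cartesian_Product.norm_nth_le Finite_Cartesian_Product.norm_nth_le] .
  have sum_entries: "(\<lambda>p. \<rho> ^ w p * cmod (M p $ i $ j)) summable_on UNIV"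
    if "0 \<le> \<rho>" "\<rho> < R" for \<rho> i j
    by (rule summable_on_comparison_test[OF summable[OF that]])
      (use that in \<open>auto intro!: mult_left_mono entry_le\<close>)
  have sum_matrix: "(\<lambda>p. mscale (s ^ w p) (M p)) summable_on UNIV" if "cmod s < R" for s
    using summable[OF norm_ge_zero that]
    by - (rule abs_summable_summable, simp add: norm_mscale norm_power)
  \<comment> \<open>the derivative of each entry, named to assemble a matrix from the entrywise statements\<close>
  define D where "D i j = deriv (\<lambda>s. \<Sum>\<^sub>\<infinity>p. s ^ w p * M p $ i $ j) z" for i j
  have D: "((\<lambda>p. of_nat (w p) * z ^ (w p - 1) * M p $ i $ j) has_sum D i j) UNIV"
    "((\<lambda>s. \<Sum>\<^sub>\<infinity>p. s ^ w p * M p $ i $ j) has_field_derivative D i j) (at z)" for i j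
  proof -
    obtain D' where D':
      "((\<lambda>p. of_nat (w p) * z ^ (w p - 1) * M p $ i $ j) has_sum D') UNIV"
      "((\<lambda>s. \<Sum>\<^sub>\<infinity>p. s ^ w p * M p $ i $ j) has_field_derivative D') (at z)"
      by (rule monomial_family_termwise_derivative[of R w "\<lambda>p. M p $ i $ j" z, OF sum_entries z])
    have "D i j = D'" unfolding D_def by (rule DERIV_imp_deriv[OF D'(2)])
    then show "((\<lambda>p. of_nat (w p) * z ^ (w p - 1) * M p $ i $ j) has_sum D i j) UNIV"
      "((\<lambda>s. \<Sum>\<^sub>\<infinity>p. s ^ w p * M p $ i $ j) has_field_derivative D i j) (at z)"
      using D' by simp_all
  qed
  show thesis
  proof (rule that[of "\<chi> i j. D i j"])
    show "((\<lambda>p. mscale (of_nat (w p) * z ^ (w p - 1)) (M p)) has_sum (\<chi> i j. D i j)) UNIV"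
      by (rule has_sum_entries) (simp only: mscale_nth vec_lambda_beta D(1))
    show "has_mderiv (\<lambda>s. \<Sum>\<^sub>\<infinity>p. mscale (s ^ w p) (M p)) (\<chi> i j. D i j) z"
      unfolding has_mderiv_def
    proof (intro allI)
      fix i j
      have eq: "(\<Sum>\<^sub>\<infinity>p. s ^ w p * M p $ i $ j) = (\<Sum>\<^sub>\<infinity>p. mscale (s ^ w p) (M p)) $ i $ j"
        if "s \<in> ball 0 R" for s
        using entry_infsum[OF sum_matrix[of s], of i j] that by (simp add: infsumI)
      have "((\<lambda>s. (\<Sum>\<^sub>\<infinity>p. mscale (s ^ w p) (M p)) $ i $ j)
          has_field_derivative D i j) (at z)"
        by (rule has_field_derivative_transform_within_open[OF D(2) open_ball[of 0 R] _ eq])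
          (use z in simp_all)
      then show "((\<lambda>s. (\<Sum>\<^sub>\<infinity>p. mscale (s ^ w p) (M p)) $ i $ j) has_field_derivative
          (\<chi> i j. D i j) $ i $ j) (at z)"
        by simp
    qed
  qed
qed

text \<open>
  Applying \<open>t d/dt\<close> instead of \<open>d/dt\<close> to a monomial keeps its exponent and
  avoids the truncated subtraction \<open>k - 1\<close>.
\<close>

lemma mscale_euler:
  "mscale t (mscale (of_nat k * t ^ (k - 1)) M) = mscale (of_nat k) (mscale (t ^ k) M)"
  by (cases k) (simp_all add: mscale_mscale mult_ac)

section \<open>The matrix exponential and matrix powers\<close>

lemma norm_mpow_le: "norm (mpow M n) \<le> norm (mat 1 :: complex^'d^'d) * norm (M :: complex^'d^'d) ^ n"
proof (induction n)
  case (Suc n)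
  have "norm (mpow M (Suc n)) \<le> norm (mpow M n) * norm M" by (simp add: norm_matrix_mult_le)
  also have "\<dots> \<le> (norm (mat 1 :: complex^'d^'d) * norm M ^ n) * norm M"
    by (intro mult_right_mono Suc) simp
  finally show ?case by (simp add: mult_ac)
qed simp

lemma mpow_mscale: "mpow (mscale z M) n = mscale (z ^ n) (mpow M n)"
  by (induction n) (simp_all add: mscale_mult_left mscale_mult_right mscale_mscale mult.commute)

lemma mpow_commute: "X ** M = M ** X \<Longrightarrow> X ** mpow M n = mpow M n ** X"
  by (induction n) (simp_all add: commute_mult)

text \<open>
  The majorant is a scalar exponential series. Its constant is the norm of the identity, since the
  Euclidean norm of \<^term>\<open>mat 1\<close> is not \<open>1\<close> in general.
\<close>

lemma mexp_terms_summable: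
  fixes M :: "complex^'d^'d"
  assumes "0 \<le> \<rho>"
  shows "(\<lambda>n. \<rho> ^ n * norm (mscale (1 / fact n) (mpow M n))) summable_on (UNIV :: nat set)"
proof (rule summable_on_comparison_test)
  have "summable (\<lambda>n. inverse (fact n) * (\<rho> * norm M) ^ n)" by (rule summable_exp)
  then have "(\<lambda>n. inverse (fact n) * (\<rho> * norm M) ^ n) summable_on UNIV"
    using assms by (intro norm_summable_imp_summable_on) (simp add: abs_mult)
  then show "(\<lambda>n. norm (mat 1 :: complex^'d^'d) * (inverse (fact n) * (\<rho> * norm M) ^ n))
      summable_on UNIV"
    by (rule summable_on_cmult_right)
  show "\<rho> ^ n * norm (mscale (1 / fact n) (mpow M n))
      \<le> norm (mat 1 :: complex^'d^'d) * (inverse (fact n) * (\<rho> * norm M) ^ n)" for n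
  proof -
    have "\<rho> ^ n / fact n * norm (mpow M n) \<le> \<rho> ^ n / fact n * (norm (mat 1 :: complex^'d^'d) * norm M ^ n)"
      using assms by (intro mult_left_mono norm_mpow_le) simp
    then show ?thesis
      by (simp add: norm_mscale norm_divide field_simps power_mult_distrib)
  qed
qed (use assms in auto)

lemma mexp_has_sum:
  "((\<lambda>n. mscale (z ^ n) (mscale (1 / fact n) (mpow M n))) has_sum mexp (mscale z M)) UNIV"
proof -
  have "(\<lambda>n. mscale (z ^ n) (mscale (1 / fact n) (mpow M n))) summable_on UNIV"
    using mexp_terms_summable[OF norm_ge_zero[of z], of M]
    by - (rule abs_summable_summable, simp add: norm_mscale norm_power)
  then have h: "((\<lambda>n. mscale (z ^ n) (mscale (1 / fact n) (mpow M n))) has_sum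
      (\<Sum>\<^sub>\<infinity>n. mscale (z ^ n) (mscale (1 / fact n) (mpow M n)))) UNIV"
    by (rule has_sum_infsum)
  have "mexp (mscale z M) = (\<Sum>n. mscale (z ^ n) (mscale (1 / fact n) (mpow M n)))"
    by (simp add: mexp_def mpow_mscale mscale_mscale)
  then show ?thesis
    using h sums_unique[OF has_sum_imp_sums[OF h]] by simp
qed

lemma mexp_zero: "mexp (mscale 0 M) = mat 1"
proof -
  have "((\<lambda>n. mscale (0 ^ n) (mscale (1 / fact n) (mpow M n))) has_sum mat 1) (UNIV :: nat set)"
    by (rule has_sum_finite_neutralI[of "{0}"]) (auto simp: power_0_left)
  then show ?thesis using mexp_has_sum[of 0 M] has_sum_unique by blast
qed

lemma mexp_commute:
  assumes "X ** M = M ** X"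
  shows "X ** mexp (mscale z M) = mexp (mscale z M) ** X"
proof -
  have "X ** mscale (z ^ n) (mscale (1 / fact n) (mpow M n)) =
      mscale (z ^ n) (mscale (1 / fact n) (mpow M n)) ** X" for n
    by (simp add: mscale_mult_left mscale_mult_right mpow_commute[OF assms])
  then show ?thesis
    using has_sum_bounded_linear[OF bounded_linear_mult_left[of X] mexp_has_sum[of z M]]
      has_sum_bounded_linear[OF bounded_linear_mult_right[of X] mexp_has_sum[of z M]]
    by (simp add: has_sum_unique)
qed

text \<open>
  Termwise differentiation turns \<open>z\<^sup>n M\<^sup>n / n!\<close> into the preceding term
  multiplied by \<open>M\<close>.
\<close>

lemma has_mderiv_mexp: "has_mderiv (\<lambda>z. mexp (mscale z M)) (M ** mexp (mscale z M)) z"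
proof -
  let ?T = "\<lambda>n. mscale (1 / fact n) (mpow M n)"
  have "cmod z < cmod z + 1" by simp
  from has_mderiv_monomial_family[of "cmod z + 1" "\<lambda>n. n" ?T, OF mexp_terms_summable this]
  obtain D where D: "((\<lambda>n. mscale (of_nat n * z ^ (n - 1)) (?T n)) has_sum D) UNIV"
    "has_mderiv (\<lambda>s. \<Sum>\<^sub>\<infinity>n. mscale (s ^ n) (?T n)) D z"
    by blast
  have zero: "mscale (of_nat n * z ^ (n - 1)) (?T n) = 0" if "n \<notin> range Suc" for n
    using that by (cases n) auto
  have "((\<lambda>n. mscale (of_nat (Suc n) * z ^ n) (?T (Suc n))) has_sum D) UNIV"
    using has_sum_reindex_support[OF D(1) inj_Suc zero] by simp
  moreover have "mscale (of_nat (Suc n) * z ^ n) (?T (Suc n)) = M ** mscale (z ^ n) (?T n)" for n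
    by (simp add: mscale_mult_right mscale_mscale mpow_commute field_simps del: of_nat_Suc)
  ultimately have "((\<lambda>n. M ** mscale (z ^ n) (?T n)) has_sum D) UNIV" by simp
  then have "D = M ** mexp (mscale z M)"
    using has_sum_unique has_sum_bounded_linear[OF bounded_linear_mult_left[of M] mexp_has_sum[of z M]]
    by blast
  moreover have "(\<Sum>\<^sub>\<infinity>n. mscale (s ^ n) (?T n)) = mexp (mscale s M)" for s
    by (rule infsumI[OF mexp_has_sum])
  ultimately show ?thesis using D(2) by simp
qed

text \<open>
  Multiply \<open>exp (z (M + c I))\<close> by \<open>exp (- c z)\<close>. The result and \<open>exp (z M)\<close> both solve
  \<open>F' = M F\<close> with \<open>F 0 = I\<close>. For any such solution \<open>exp (- z M) F z\<close> has derivative zero, so it equals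
  \<open>I\<close>; hence both are the inverse of \<open>exp (- z M)\<close>.
\<close>

lemma mexp_add_mat:
  "mexp (mscale z (M + mat c)) = mscale (exp (c * z)) (mexp (mscale z M))"
proof -
  let ?E = "\<lambda>z. mexp (mscale z M)" and ?N = "\<lambda>z. mexp (mscale (- z) M)"
  let ?G = "\<lambda>z. mscale (exp (- c * z)) (mexp (mscale z (M + mat c)))"
  have dN: "has_mderiv ?N (mscale (- 1) (M ** ?N z)) z" for z
    by (rule has_mderiv_compose[OF has_mderiv_mexp[of M]]) (auto intro!: derivative_eq_intros)
  have dG: "has_mderiv ?G (M ** ?G z) z" for z
  proof -
    have "has_mderiv ?G (mscale (- c * exp (- c * z)) (mexp (mscale z (M + mat c))) +
        mscale (exp (- c * z)) ((M + mat c) ** mexp (mscale z (M + mat c)))) z"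
      by (rule has_mderiv_mscale[OF _ has_mderiv_mexp]) (auto intro!: derivative_eq_intros)
    moreover have "mscale (- c * exp (- c * z)) X + mscale (exp (- c * z)) ((M + mat c) ** X) =
        M ** mscale (exp (- c * z)) X" for X
      unfolding matrix_add_rdistrib mat_mult mscale_mult_right
      by (simp add: vec_eq_iff algebra_simps)
    ultimately show ?thesis by (simp only:)
  qed
  \<comment> \<open>uniqueness of the solution of \<open>F' = M F\<close>\<close>
  have dP: "?N t ** F t = F 0" if F: "\<And>z. has_mderiv F (M ** F z) z" for F t
  proof -
    have "has_mderiv (\<lambda>z. ?N z ** F z) 0 z" for z
    proof -
      have "mscale (- 1) (M ** ?N z) ** F z + ?N z ** (M ** F z) = 0"
        unfolding matrix_mul_assoc mexp_commute[of M M "- z", OF refl, symmetric] mscale_mult_left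
        by (simp add: vec_eq_iff)
      then show ?thesis using has_mderiv_mult[OF dN[of z] F[of z]] by simp
    qed
    from has_mderiv_zero_constant[OF this, of t] show ?thesis
      using mexp_zero[of M] by simp
  qed
  have "?N z ** ?E z = mat 1" "?N z ** ?G z = mat 1"
    using dP[OF has_mderiv_mexp] dP[OF dG] mexp_zero[of M] mexp_zero[of "M + mat c"] by simp_all
  then have "?E z = ?G z"
    by (metis matrix_inv_unique_left)
  then show ?thesis
    by (simp add: mscale_mscale flip: exp_add)
qed

lemma mpowr_add_mat:
  assumes "x \<noteq> 0"
  shows "mpowr x (M + mat c) = mscale (x powr c) (mpowr x M)"
  using assms by (simp add: mpowr_def mexp_add_mat powr_def)

lemma mpowr_add_one:
  assumes "t \<noteq> 0"
  shows "mpowr t (M + mat 1) = mscale t (mpowr t M)"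
  using mpowr_add_mat[OF assms, of M 1] assms by simp

lemma mpowr_diff_one:
  assumes "t \<noteq> 0"
  shows "mpowr t (M - mat 1) = mscale (1 / t) (mpowr t M)"
  using mpowr_add_one[OF assms, of "M - mat 1"] assms by (simp add: mscale_mscale)

lemma mpowr_commute: "X ** M = M ** X \<Longrightarrow> X ** mpowr x M = mpowr x M ** X"
  by (simp add: mpowr_def mexp_commute)

lemma has_mderiv_mpowr:
  assumes "t \<notin> \<real>\<^sub>\<le>\<^sub>0"
  shows "has_mderiv (\<lambda>s. mpowr s M) (mscale (1 / t) (M ** mpowr t M)) t"
  unfolding mpowr_def
  by (rule has_mderiv_compose[OF has_mderiv_mexp])
    (use assms in \<open>auto intro!: derivative_eq_intros simp: divide_inverse\<close>)

section \<open>Convergence of the double series\<close>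

text \<open>
  The finitely many indices where the ratio condition fails are absorbed into the constant
  \<open>K\<close>.
\<close>

lemma eventually_ratio_imp_geometric_bound:
  fixes u :: "nat \<Rightarrow> real"
  assumes "\<And>n. u n \<ge> 0" "q > 0" "\<forall>\<^sub>F n in sequentially. u (Suc n) \<le> q * u n"
  obtains K where "K \<ge> 0" "\<And>n. u n \<le> K * q ^ n"
proof -
  obtain N where N: "\<And>n. n \<ge> N \<Longrightarrow> u (Suc n) \<le> q * u n"
    using assms(3) by (auto simp: eventually_sequentially)
  define K where "K = (\<Sum>n\<le>N. u n / q ^ n)"
  have small: "u n \<le> K * q ^ n" if "n \<le> N" for n
  proof -
    have "u n / q ^ n \<le> K"
      unfolding K_def using that assms by (intro member_le_sum) auto
    then show ?thesis using assms(2) by (simp add: pos_divide_le_eq)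
  qed
  have large: "u n \<le> K * q ^ n" if "N \<le> n" for n
    using that
  proof (induction n rule: dec_induct)
    case base
    show ?case by (rule small) simp
  next
    case (step n)
    have "u (Suc n) \<le> q * (K * q ^ n)"
      using N[of n] step mult_left_mono[of "u n" "K * q ^ n" q] assms(2) by linarith
    then show ?case by (simp add: mult_ac)
  qed
  show thesis
  proof (rule that)
    show "K \<ge> 0" unfolding K_def using assms by (intro sum_nonneg) auto
    show "u n \<le> K * q ^ n" for n using small large by (cases "n \<le> N") auto
  qed
qed

text \<open>
  Passing from \<open>n\<close> to \<open>n + 1\<close> multiplies the norm by at most \<open>norm A + n\<close>, and
  \<open>(norm A + n) / (n + 1)\<close> tends to \<open>1\<close>. The estimate must split \<open>A + n I\<close> before taking norms: the bound
  \<open>norm A + n * norm I\<close> would have a ratio that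
  tends to \<open>norm I\<close>, which exceeds \<open>1\<close> for matrices of size at least \<open>2\<close>.
\<close>

lemma norm_mpochhammer_bound:
  fixes A :: "complex^'d^'d"
  assumes "q > 1"
  obtains K where "K \<ge> 0" "\<And>n. norm (mpochhammer A n) \<le> K * q ^ n * fact n"
proof -
  define u where "u n = norm (mpochhammer A n) / fact n" for n
  \<comment> \<open>the threshold is where \<open>norm A + n \<le> q n\<close>\<close>
  have "\<forall>\<^sub>F n in sequentially. real n \<ge> norm A / (q - 1)"
    using filterlim_real_sequentially by (simp add: filterlim_at_top)
  then have "\<forall>\<^sub>F n in sequentially. u (Suc n) \<le> q * u n"
  proof eventually_elim
    case (elim n)
    have "norm A + n \<le> q * n"
      using elim assms by (simp add: pos_divide_le_eq algebra_simps)
    then have le: "norm A + n \<le> q * (n + 1)" using assms by (simp add: algebra_simps)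
    have "norm (mpochhammer A (Suc n)) =
        norm (mpochhammer A n ** A + mscale (of_nat n) (mpochhammer A n))"
      by (simp add: matrix_add_ldistrib mult_mat)
    also have "\<dots> \<le> norm (mpochhammer A n) * norm A + n * norm (mpochhammer A n)"
      by (rule order_trans[OF norm_triangle_ineq])
        (simp add: norm_mscale norm_matrix_mult_le add_mono)
    also have "\<dots> = norm (mpochhammer A n) * (norm A + n)" by (simp add: algebra_simps)
    also have "\<dots> \<le> norm (mpochhammer A n) * (q * (n + 1))"
      by (rule mult_left_mono[OF le]) simp
    finally have "u (Suc n) \<le> norm (mpochhammer A n) * (q * (n + 1)) / fact (Suc n)"
      unfolding u_def by (rule divide_right_mono) simp
    also have "\<dots> = q * u n"
    proof -
      have "real n + 1 \<noteq> 0" by linarith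
      moreover have "fact (Suc n) = (real n + 1) * fact n" by (simp add: algebra_simps)
      ultimately show ?thesis by (simp add: u_def add.commute del: fact_Suc)
    qed
    finally show ?case .
  qed
  from eventually_ratio_imp_geometric_bound[of u, OF _ _ this] assms
  obtain K where K: "K \<ge> 0" "\<And>n. u n \<le> K * q ^ n"
    by (auto simp: u_def)
  show thesis
    using K by (intro that[of K]) (auto simp: u_def pos_divide_le_eq)
qed

text \<open>
  With \<open>X\<^sub>n\<close> the inverse of \<open>(C)\<^sub>n\<close>, the identity \<open>(C + n I) X\<^sub>n\<^sub>+\<^sub>1 = X\<^sub>n\<close> gives
  \<open>(n - norm C) * norm X\<^sub>n\<^sub>+\<^sub>1 \<le> norm X\<^sub>n\<close>, and \<open>(n + 1) / (n - norm C)\<close> tends to \<open>1\<close>.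
\<close>

lemma norm_inv_mpochhammer_bound:
  fixes C :: "complex^'d^'d"
  assumes C: "\<And>k::nat. invertible (C + mat (of_nat k))" and "q > 1"
  obtains K where "K \<ge> 0" "\<And>n. norm (matrix_inv (mpochhammer C n)) \<le> K * q ^ n / fact n"
proof -
  define X where "X n = matrix_inv (mpochhammer C n)" for n
  define u where "u n = fact n * norm (X n)" for n
  \<comment> \<open>the threshold is where \<open>n + 1 \<le> q (n - norm C)\<close>\<close>
  have "\<forall>\<^sub>F n in sequentially. real n \<ge> (1 + q * norm C) / (q - 1)"
    using filterlim_real_sequentially by (simp add: filterlim_at_top)
  then have "\<forall>\<^sub>F n in sequentially. u (Suc n) \<le> q * u n"
  proof eventually_elim
    case (elim n)
    have "1 + q * norm C \<le> n * (q - 1)"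
      using elim assms(2) by (simp add: pos_divide_le_eq)
    then have le: "n + 1 \<le> q * (n - norm C)" by (simp add: algebra_simps)
    have "X n = (C + mat (of_nat n)) ** X (Suc n)"
      unfolding X_def using C[of n] invertible_mpochhammer[OF C, of n]
      by (simp add: matrix_inv_mult matrix_mul_assoc matrix_inv_cancel)
    then have "mscale (of_nat n) (X (Suc n)) = X n - C ** X (Suc n)"
      by (simp add: matrix_add_rdistrib mat_mult)
    then have "n * norm (X (Suc n)) = norm (X n - C ** X (Suc n))"
      by (metis norm_mscale norm_of_nat)
    also have "\<dots> \<le> norm (X n) + norm C * norm (X (Suc n))"
      by (rule order_trans[OF norm_triangle_ineq4]) (simp add: norm_matrix_mult_le)
    finally have "(n - norm C) * norm (X (Suc n)) \<le> norm (X n)"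
      by (simp add: algebra_simps)
    then have "q * ((n - norm C) * norm (X (Suc n))) \<le> q * norm (X n)"
      using assms(2) by (intro mult_left_mono) auto
    moreover have "(n + 1) * norm (X (Suc n)) \<le> q * (n - norm C) * norm (X (Suc n))"
      by (rule mult_right_mono[OF le]) simp
    ultimately have "(n + 1) * norm (X (Suc n)) \<le> q * norm (X n)"
      by (simp add: mult.assoc)
    then have "fact n * ((n + 1) * norm (X (Suc n))) \<le> fact n * (q * norm (X n))"
      by (intro mult_left_mono) auto
    then show ?case
      unfolding u_def by (simp add: algebra_simps)
  qed
  from eventually_ratio_imp_geometric_bound[of u, OF _ _ this] assms
  obtain K where K: "K \<ge> 0" "\<And>n. u n \<le> K * q ^ n"
    by (auto simp: u_def)
  show thesis
    using K by (intro that[of K]) (auto simp: u_def X_def pos_le_divide_eq mult.commute)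
qed

text \<open>
  The coefficient of \<open>x\<^sup>m y\<^sup>n\<close> in \<^const>\<open>H6\<close>, indexed by
  \<open>p = (m, n)\<close>.
\<close>

definition hcoeff :: "complex^'d^'d \<Rightarrow> complex^'d^'d \<Rightarrow> nat \<times> nat \<Rightarrow> complex^'d^'d" where
  "hcoeff A C p = mscale (1 / (fact (fst p) * fact (snd p)))
     (mpochhammer A (2 * fst p + snd p) ** matrix_inv (mpochhammer C (fst p + snd p)))"

lemma summable_on_nonneg_product:
  fixes u v :: "nat \<Rightarrow> real"
  assumes "summable u" "summable v" "\<And>n. u n \<ge> 0" "\<And>n. v n \<ge> 0"
  shows "(\<lambda>p. u (fst p) * v (snd p)) summable_on UNIV"
proof -
  have u: "u summable_on UNIV" and v: "v summable_on UNIV"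
    using assms by (auto intro!: norm_summable_imp_summable_on)
  have "(\<lambda>p. norm (u (fst p) * v (snd p))) summable_on Sigma UNIV (\<lambda>_. UNIV)"
  proof (rule Infinite_Sum.abs_summable_on_Sigma_iff[THEN iffD2], intro conjI ballI)
    show "(\<lambda>n. norm (u (fst (m, n)) * v (snd (m, n)))) summable_on UNIV" for m
      using summable_on_cmult_right[OF v, of "u m"] assms(3,4) by (simp add: abs_mult)
    show "(\<lambda>m. norm (\<Sum>\<^sub>\<infinity>n. norm (u (fst (m, n)) * v (snd (m, n))))) summable_on UNIV"
      using summable_on_cmult_left[OF u, of "infsum v UNIV"] assms(3,4)
      by (simp add: abs_mult infsum_cmult_right' infsum_nonneg)
  qed
  then show ?thesis
    using assms(3,4) by (simp add: abs_mult)
qed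

text \<open>
  The quotient is the binomial coefficient \<open>(2 m + n) choose m\<close>. The factor \<open>4 ^
  m\<close> is where the radius \<open>1/4\<close> in \<open>x\<close> comes from.
\<close>

lemma fact_quotient_le: "fact (2 * m + n) / (fact (m + n) * fact m) \<le> (4 ^ m * 2 ^ n :: real)"
proof -
  have "fact (2 * m + n) / (fact (m + n) * fact m) = real ((2 * m + n) choose m)"
    by (simp add: binomial_fact mult_2 add.assoc mult.commute)
  also have "\<dots> \<le> real (2 ^ (2 * m + n))"
    by (rule of_nat_mono[OF binomial_le_pow2])
  also have "\<dots> = 4 ^ m * 2 ^ n" by (simp add: power_add power_mult)
  finally show ?thesis .
qed

text \<open>
  For any \<open>q > 1\<close> the norm of \<open>hcoeff A C (m, n)\<close> is at most a constant times
  \<open>q\<^bsup>3m+2n\<^esup> (2m+n)! / ((m+n)! m! n!)\<close>, hence at most a constant times \<open>(4 q\<^sup>3)\<^sup>m (2 q\<^sup>2)\<^sup>n / n!\<close>. For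
  \<open>a < 1/4\<close> one can choose \<open>q\<close> with \<open>4 a q\<^sup>3 < 1\<close>; the double series is then dominated by the product of a
  geometric and an exponential series.
\<close>

lemma hcoeff_summable:
  fixes A C :: "complex^'d^'d"
  assumes C: "\<And>k::nat. invertible (C + mat (of_nat k))" and a: "0 \<le> a" "a < 1/4" and b: "0 \<le> b"
  shows "(\<lambda>p. a ^ fst p * b ^ snd p * norm (hcoeff A C p)) summable_on UNIV"
proof -
  have "((\<lambda>q. 4 * a * q ^ 3) \<longlongrightarrow> 4 * a * 1 ^ 3) (at_right 1)"
    by (intro tendsto_intros)
  then have "\<forall>\<^sub>F q in at_right 1. 4 * a * q ^ 3 < 1"
    by (rule order_tendstoD(2)) (use a in simp)
  then have "\<forall>\<^sub>F q in at_right (1::real). 4 * a * q ^ 3 < 1 \<and> q > 1"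
    by (intro eventually_conj eventually_at_right_less)
  then obtain q where q: "4 * a * q ^ 3 < 1" "q > 1"
    by (metis (mono_tags, lifting) eventually_happens trivial_limit_at_right_real)
  obtain K where K: "K \<ge> 0" "\<And>n. norm (mpochhammer A n) \<le> K * q ^ n * fact n"
    using norm_mpochhammer_bound[OF q(2)] by blast
  obtain L where L: "L \<ge> 0" "\<And>n. norm (matrix_inv (mpochhammer C n)) \<le> L * q ^ n / fact n"
    using norm_inv_mpochhammer_bound[OF C q(2)] by blast
  define u where "u m = (4 * a * q ^ 3) ^ m" for m
  define v where "v n = inverse (fact n) * (2 * b * q ^ 2) ^ n" for n
  have pos: "u n \<ge> 0" "v n \<ge> 0" for n
    using a b q by (auto simp: u_def v_def)
  have "summable u" "summable v"
    unfolding u_def v_def using a q by (auto intro!: summable_geometric summable_exp)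
  then have "(\<lambda>p. K * L * (u (fst p) * v (snd p))) summable_on UNIV"
    by (intro summable_on_cmult_right summable_on_nonneg_product pos)
  then show ?thesis
  proof (rule summable_on_comparison_test)
    fix p :: "nat \<times> nat"
    obtain m n where p: "p = (m, n)" by fastforce
    let ?A = "mpochhammer A (2 * m + n)" and ?C = "matrix_inv (mpochhammer C (m + n))"
    have le: "norm (?A ** ?C) \<le> (K * q ^ (2 * m + n) * fact (2 * m + n)) * (L * q ^ (m + n) / fact (m + n))"
      using K L q by (intro order_trans[OF norm_matrix_mult_le] mult_mono) auto
    have "norm (hcoeff A C p) \<le>
        (K * q ^ (2 * m + n) * fact (2 * m + n)) * (L * q ^ (m + n) / fact (m + n)) / (fact m * fact n)"
      using divide_right_mono[OF le, of "fact m * fact n"]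
      by (simp add: hcoeff_def p norm_mscale norm_divide norm_mult)
    also have "\<dots> = (K * L * q ^ (3 * m + 2 * n) / fact n) *
        (fact (2 * m + n) / (fact (m + n) * fact m))"
    proof -
      have "3 * m + 2 * n = (2 * m + n) + (m + n)" by simp
      then have "q ^ (3 * m + 2 * n) = q ^ (2 * m + n) * q ^ (m + n)"
        by (simp only: power_add)
      then show ?thesis by (simp add: field_simps)
    qed
    also have "\<dots> \<le> (K * L * q ^ (3 * m + 2 * n) / fact n) * (4 ^ m * 2 ^ n)"
      using K L q by (intro mult_left_mono fact_quotient_le) auto
    finally have "a ^ m * b ^ n * norm (hcoeff A C p) \<le>
        a ^ m * b ^ n * ((K * L * q ^ (3 * m + 2 * n) / fact n) * (4 ^ m * 2 ^ n))"
      using a b by (intro mult_left_mono) auto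
    also have "\<dots> = K * L * (u m * v n)"
    proof -
      have "q ^ (3 * m + 2 * n) = (q ^ 3) ^ m * (q ^ 2) ^ n"
        by (simp only: power_add power_mult)
      then show ?thesis
        by (simp add: u_def v_def power_mult_distrib divide_inverse mult_ac)
    qed
    finally show "a ^ fst p * b ^ snd p * norm (hcoeff A C p) \<le> K * L * (u (fst p) * v (snd p))"
      by (simp add: p)
  qed (use a b in auto)
qed

lemma H6_eq_infsum: "H6 A C x y = (\<Sum>\<^sub>\<infinity>p. mscale (x ^ fst p * y ^ snd p) (hcoeff A C p))"
  by (simp add: H6_def hcoeff_def case_prod_unfold mscale_mscale)

lemma H6_has_sum:
  assumes "\<And>k::nat. invertible (C + mat (of_nat k))" "cmod x < 1/4"
  shows "((\<lambda>p. mscale (x ^ fst p * y ^ snd p) (hcoeff A C p)) has_sum H6 A C x y) UNIV"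
  unfolding H6_eq_infsum
  by (rule has_sum_infsum, rule abs_summable_summable)
    (use hcoeff_summable[OF assms(1), of "cmod x" "cmod y" A] assms(2) in
      \<open>simp add: norm_mscale norm_mult norm_power\<close>)

section \<open>Contiguity relations of the coefficients\<close>

text \<open>
  Raising \<open>m\<close> by one raises the index of \<open>(A)\<^sub>2\<^sub>m\<^sub>+\<^sub>n\<close>
  by two and that of \<open>(C)\<^sub>m\<^sub>+\<^sub>n\<close> by one. The new factors are split off at
  the left end of each Pochhammer product, which shifts the parameters by \<open>2\<close> and
  \<open>1\<close>.
\<close>

lemma hcoeff_Suc_fst:
  assumes "\<And>k::nat. invertible (C + mat (of_nat k))"
  shows "mscale (of_nat (Suc m)) (hcoeff A C (Suc m, n)) =
    A ** (A + mat 1) ** hcoeff (A + mat 2) (C + mat 1) (m, n) ** matrix_inv C"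
proof -
  have "mpochhammer A (2 * Suc m + n) = A ** (A + mat 1) ** mpochhammer (A + mat 2) (2 * m + n)"
    using mpochhammer_Suc_left[of A "Suc (2 * m + n)"] mpochhammer_Suc_left[of "A + mat 1" "2 * m + n"]
    by (simp add: matrix_mul_assoc mat_add add.assoc del: mpochhammer.simps)
  moreover have "matrix_inv (mpochhammer C (Suc m + n)) =
      matrix_inv (mpochhammer (C + mat 1) (m + n)) ** matrix_inv C"
    using matrix_inv_mpochhammer_Suc[OF assms, of "m + n"] by (simp del: mpochhammer.simps)
  moreover have "of_nat (Suc m) / (fact (Suc m) * fact n) = (1 / (fact m * fact n) :: complex)"
    by (simp del: of_nat_Suc)
  ultimately show ?thesis
    by (simp add: hcoeff_def mscale_mscale mscale_mult_left mscale_mult_right matrix_mul_assoc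
        del: of_nat_Suc fact_Suc mpochhammer.simps)
qed

lemma hcoeff_Suc_snd:
  assumes "\<And>k::nat. invertible (C + mat (of_nat k))"
  shows "mscale (of_nat (Suc n)) (hcoeff A C (m, Suc n)) =
    A ** hcoeff (A + mat 1) (C + mat 1) (m, n) ** matrix_inv C"
proof -
  have "mpochhammer A (2 * m + Suc n) = A ** mpochhammer (A + mat 1) (2 * m + n)"
    using mpochhammer_Suc_left[of A "2 * m + n"] by simp
  moreover have "matrix_inv (mpochhammer C (m + Suc n)) =
      matrix_inv (mpochhammer (C + mat 1) (m + n)) ** matrix_inv C"
    using matrix_inv_mpochhammer_Suc[OF assms, of "m + n"] by (simp del: mpochhammer.simps)
  moreover have "of_nat (Suc n) / (fact m * fact (Suc n)) = (1 / (fact m * fact n) :: complex)"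
    by (simp del: of_nat_Suc)
  ultimately show ?thesis
    by (simp add: hcoeff_def mscale_mscale mscale_mult_left mscale_mult_right matrix_mul_assoc
        del: of_nat_Suc fact_Suc mpochhammer.simps)
qed

text \<open>
  The Euler operator acts on \<open>t\<^sup>A\<close> times a monomial of degree \<open>k = 2m+n\<close>
  in \<open>t\<close> as multiplication by \<open>A + k I\<close>, and \<open>(A + k I) (A)\<^sub>k = A
  (A + I)\<^sub>k\<close>.
\<close>

lemma hcoeff_raise:
  "(A + mat (of_nat (2 * fst p + snd p))) ** hcoeff A C p = A ** hcoeff (A + mat 1) C p"
proof -
  let ?k = "2 * fst p + snd p"
  have "(A + mat (of_nat ?k)) ** A = A ** (A + mat (of_nat ?k))"
    by (rule commute_add_mat[OF refl, symmetric])
  then have "(A + mat (of_nat ?k)) ** mpochhammer A ?k = mpochhammer A ?k ** (A + mat (of_nat ?k))"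
    by (rule commute_mpochhammer)
  then have "(A + mat (of_nat ?k)) ** mpochhammer A ?k = A ** mpochhammer (A + mat 1) ?k"
    by (simp only: mpochhammer_shift)
  then show ?thesis
    by (simp only: hcoeff_def mscale_mult_right matrix_mul_assoc)
qed

text \<open>
  The same for a monomial of degree \<open>k = m+n\<close> times \<open>t\<^sup>B\<close>, where
  \<open>C = B + I\<close>. Inverting \<open>B (B + I)\<^sub>k = (B)\<^sub>k (B + k I)\<close> lowers
  the denominator parameter by one.
\<close>

lemma hcoeff_lower:
  assumes "\<And>k::nat. invertible (B + mat (of_nat k))"
  shows "hcoeff A (B + mat 1) p ** (B + mat (of_nat (fst p + snd p))) = hcoeff A B p ** B"
proof -
  let ?k = "fst p + snd p"
  let ?P = "mpochhammer B ?k" and ?Q = "mpochhammer (B + mat 1) ?k" and ?X = "B + mat (of_nat ?k)"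
  have P: "invertible ?P" by (rule invertible_mpochhammer[OF assms])
  have Q: "invertible ?Q"
    by (rule invertible_mpochhammer) (use invertible_shift[OF assms, of 1] in simp)
  have XB: "?X ** B = B ** ?X" by (rule commute_add_mat[OF refl, symmetric])
  have "?X ** ?Q = ?Q ** ?X"
    by (rule commute_mpochhammer[OF commute_add_mat[OF XB]])
  then have "matrix_inv ?Q ** ?X = ?X ** matrix_inv ?Q"
    using matrix_inv_commute[OF _ Q] by simp
  also have "\<dots> = matrix_inv ?P ** (?P ** ?X) ** matrix_inv ?Q"
    by (simp add: matrix_mul_assoc matrix_inv_cancel[OF P])
  also have "\<dots> = matrix_inv ?P ** B ** (?Q ** matrix_inv ?Q)"
    by (simp only: mpochhammer_shift[symmetric] matrix_mul_assoc)
  also have "\<dots> = matrix_inv ?P ** B"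
    by (simp add: matrix_inv_cancel[OF Q])
  finally have "matrix_inv ?Q ** ?X = matrix_inv ?P ** B" .
  then show ?thesis
    by (simp only: hcoeff_def mscale_mult_left matrix_mul_assoc[symmetric])
qed

section \<open>First derivatives\<close>

text \<open>
  Along \<open>x\<close> the exponent of the monomial indexed by \<open>(m, n)\<close> is
  \<open>m\<close>. The terms with \<open>m = 0\<close> vanish after differentiation, and shifting
  \<open>m\<close> brings the remaining ones back to the form of the series.
\<close>

lemma has_mderiv_H6_x:
  assumes C: "\<And>k::nat. invertible (C + mat (of_nat k))" and x: "cmod x < 1/4"
  shows "has_mderiv (\<lambda>t. H6 A C t y)
    (A ** (A + mat 1) ** H6 (A + mat 2) (C + mat 1) x y ** matrix_inv C) x"
proof -
  let ?M = "\<lambda>p. mscale (y ^ snd p) (hcoeff A C p)"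
  have "(\<lambda>p. \<rho> ^ fst p * norm (?M p)) summable_on UNIV" if "0 \<le> \<rho>" "\<rho> < 1/4" for \<rho>
    using hcoeff_summable[OF C that norm_ge_zero[of y], of A]
    by (simp add: norm_mscale norm_power mult.assoc)
  from has_mderiv_monomial_family[of "1/4" fst ?M x, OF this x]
  obtain D where D: "((\<lambda>p. mscale (of_nat (fst p) * x ^ (fst p - 1)) (?M p)) has_sum D) UNIV"
    and deriv: "has_mderiv (\<lambda>s. \<Sum>\<^sub>\<infinity>p. mscale (s ^ fst p) (?M p)) D x"
    by blast
  let ?h = "\<lambda>p :: nat \<times> nat. (Suc (fst p), snd p)"
  have "((\<lambda>p. mscale (of_nat (fst (?h p)) * x ^ (fst (?h p) - 1)) (?M (?h p))) has_sum D) UNIV"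
  proof (rule has_sum_reindex_support[OF D])
    show "inj ?h" by (auto simp: inj_def prod_eq_iff)
    show "mscale (of_nat (fst p) * x ^ (fst p - 1)) (?M p) = 0" if "p \<notin> range ?h" for p
    proof -
      obtain m n where p: "p = (m, n)" by fastforce
      have "m = 0"
      proof (rule ccontr)
        assume "m \<noteq> 0"
        then have "p = ?h (m - 1, n)" by (simp add: p)
        then show False using that by blast
      qed
      then show ?thesis by (simp add: p)
    qed
  qed
  moreover have "mscale (of_nat (fst (?h p)) * x ^ (fst (?h p) - 1)) (?M (?h p)) =
      A ** (A + mat 1) ** mscale (x ^ fst p * y ^ snd p) (hcoeff (A + mat 2) (C + mat 1) p)
        ** matrix_inv C" for p
  proof -
    have "mscale (of_nat (fst (?h p)) * x ^ (fst (?h p) - 1)) (?M (?h p)) =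
        mscale (x ^ fst p * y ^ snd p)
          (mscale (of_nat (Suc (fst p))) (hcoeff A C (Suc (fst p), snd p)))"
      by (simp add: mscale_mscale mult_ac del: of_nat_Suc)
    then show ?thesis
      unfolding hcoeff_Suc_fst[OF C] by (simp add: mscale_mult_left mscale_mult_right)
  qed
  moreover have "((\<lambda>p. A ** (A + mat 1) ** mscale (x ^ fst p * y ^ snd p)
      (hcoeff (A + mat 2) (C + mat 1) p) ** matrix_inv C) has_sum
      A ** (A + mat 1) ** H6 (A + mat 2) (C + mat 1) x y ** matrix_inv C) UNIV"
    using invertible_shift[OF C, of 1]
    by (intro has_sum_bounded_linear[OF bounded_linear_mult_right]
        has_sum_bounded_linear[OF bounded_linear_mult_left] H6_has_sum x) simp_all
  ultimately have "D = A ** (A + mat 1) ** H6 (A + mat 2) (C + mat 1) x y ** matrix_inv C"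
    by (simp only: has_sum_unique)
  then show ?thesis
    using deriv by (simp add: H6_eq_infsum mscale_mscale)
qed

text \<open>
  Here \<open>y\<close> may be arbitrary, so the radius passed to the termwise differentiation is just a
  number exceeding \<open>cmod y\<close>.
\<close>

lemma has_mderiv_H6_y:
  assumes C: "\<And>k::nat. invertible (C + mat (of_nat k))" and x: "cmod x < 1/4"
  shows "has_mderiv (\<lambda>t. H6 A C x t)
    (A ** H6 (A + mat 1) (C + mat 1) x y ** matrix_inv C) y"
proof -
  let ?M = "\<lambda>p. mscale (x ^ fst p) (hcoeff A C p)"
  have "(\<lambda>p. \<rho> ^ snd p * norm (?M p)) summable_on UNIV" if "0 \<le> \<rho>" for \<rho>
    using hcoeff_summable[OF C norm_ge_zero x that, of A]
    by (simp add: norm_mscale norm_power mult_ac)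
  from has_mderiv_monomial_family[of "cmod y + 1" snd ?M y, OF this]
  obtain D where D: "((\<lambda>p. mscale (of_nat (snd p) * y ^ (snd p - 1)) (?M p)) has_sum D) UNIV"
    and deriv: "has_mderiv (\<lambda>s. \<Sum>\<^sub>\<infinity>p. mscale (s ^ snd p) (?M p)) D y"
    by auto
  let ?h = "\<lambda>p :: nat \<times> nat. (fst p, Suc (snd p))"
  have "((\<lambda>p. mscale (of_nat (snd (?h p)) * y ^ (snd (?h p) - 1)) (?M (?h p))) has_sum D) UNIV"
  proof (rule has_sum_reindex_support[OF D])
    show "inj ?h" by (auto simp: inj_def prod_eq_iff)
    show "mscale (of_nat (snd p) * y ^ (snd p - 1)) (?M p) = 0" if "p \<notin> range ?h" for p
    proof -
      obtain m n where p: "p = (m, n)" by fastforce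
      have "n = 0"
      proof (rule ccontr)
        assume "n \<noteq> 0"
        then have "p = ?h (m, n - 1)" by (simp add: p)
        then show False using that by blast
      qed
      then show ?thesis by (simp add: p)
    qed
  qed
  moreover have "mscale (of_nat (snd (?h p)) * y ^ (snd (?h p) - 1)) (?M (?h p)) =
      A ** mscale (x ^ fst p * y ^ snd p) (hcoeff (A + mat 1) (C + mat 1) p)
        ** matrix_inv C" for p
  proof -
    have "mscale (of_nat (snd (?h p)) * y ^ (snd (?h p) - 1)) (?M (?h p)) =
        mscale (x ^ fst p * y ^ snd p)
          (mscale (of_nat (Suc (snd p))) (hcoeff A C (fst p, Suc (snd p))))"
      by (simp add: mscale_mscale mult_ac del: of_nat_Suc)
    then show ?thesis
      unfolding hcoeff_Suc_snd[OF C] by (simp add: mscale_mult_left mscale_mult_right)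
  qed
  moreover have "((\<lambda>p. A ** mscale (x ^ fst p * y ^ snd p)
      (hcoeff (A + mat 1) (C + mat 1) p) ** matrix_inv C) has_sum
      A ** H6 (A + mat 1) (C + mat 1) x y ** matrix_inv C) UNIV"
    using invertible_shift[OF C, of 1]
    by (intro has_sum_bounded_linear[OF bounded_linear_mult_right]
        has_sum_bounded_linear[OF bounded_linear_mult_left] H6_has_sum x) simp_all
  ultimately have "D = A ** H6 (A + mat 1) (C + mat 1) x y ** matrix_inv C"
    by (simp only: has_sum_unique)
  then show ?thesis
    using deriv by (simp add: H6_eq_infsum mscale_mscale mult.commute)
qed

text \<open>
  Along the curve \<open>(t\<^sup>2, y t)\<close> the monomial indexed by \<open>(m, n)\<close> has degree \<open>k = 2m+n\<close> in \<open>t\<close>, and the disc for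
  \<open>t\<close> has radius \<open>1/2\<close>. With \<open>G\<close> the series and \<open>P = t\<^sup>A\<close>, the product rule gives
  \<open>t (P G)' = P (A G + t G')\<close>, and the bracket is the sum of the terms multiplied by \<open>A + k I\<close>.
\<close>

lemma has_mderiv_mpowr_mult_H6:
  assumes C: "\<And>k::nat. invertible (C + mat (of_nat k))"
    and t: "cmod (t ^ 2) < 1/4" "t \<notin> \<real>\<^sub>\<le>\<^sub>0"
  shows "has_mderiv (\<lambda>s. mpowr s A ** H6 A C (s ^ 2) (y * s))
    (mscale (1 / t) (mpowr t A ** (A ** H6 (A + mat 1) C (t ^ 2) (y * t)))) t"
proof -
  let ?w = "\<lambda>p :: nat \<times> nat. 2 * fst p + snd p"
  let ?M = "\<lambda>p. mscale (y ^ snd p) (hcoeff A C p)"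
  have t0: "t \<noteq> 0" using t(2) by auto
  have half: "cmod t < 1/2"
    using t(1) by (intro power_less_imp_less_base[of "cmod t" 2])
      (auto simp: norm_mult power2_eq_square)
  have monomial: "mscale (s ^ ?w p) (?M p) = mscale ((s ^ 2) ^ fst p * (y * s) ^ snd p) (hcoeff A C p)" for s p
  proof -
    have "s ^ ?w p * y ^ snd p = (s ^ 2) ^ fst p * (y * s) ^ snd p"
      unfolding power_add power_mult power_mult_distrib by (simp only: mult_ac)
    then show ?thesis by (simp only: mscale_mscale)
  qed
  have "(\<lambda>p. \<rho> ^ ?w p * norm (?M p)) summable_on UNIV" if "0 \<le> \<rho>" "\<rho> < 1/2" for \<rho>
  proof -
    have "\<rho> ^ 2 < (1/2) ^ 2" using that by (intro power_strict_mono) auto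
    then have "\<rho> ^ 2 < 1/4" by (simp add: power2_eq_square)
    then have "(\<lambda>p. (\<rho> ^ 2) ^ fst p * (cmod y * \<rho>) ^ snd p * norm (hcoeff A C p)) summable_on UNIV"
      using that by (intro hcoeff_summable C) auto
    moreover have "\<rho> ^ ?w p * norm (?M p) =
        (\<rho> ^ 2) ^ fst p * (cmod y * \<rho>) ^ snd p * norm (hcoeff A C p)" for p
      unfolding norm_mscale norm_power power_add power_mult power_mult_distrib
      by (simp only: mult_ac)
    ultimately show ?thesis by simp
  qed
  from has_mderiv_monomial_family[of "1/2" ?w ?M t, OF this half]
  obtain D where D: "((\<lambda>p. mscale (of_nat (?w p) * t ^ (?w p - 1)) (?M p)) has_sum D) UNIV"
    and deriv: "has_mderiv (\<lambda>s. \<Sum>\<^sub>\<infinity>p. mscale (s ^ ?w p) (?M p)) D t"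
    by blast
  let ?G = "H6 A C (t ^ 2) (y * t)"
  have dG: "has_mderiv (\<lambda>s. H6 A C (s ^ 2) (y * s)) D t"
    using deriv by (simp only: monomial H6_eq_infsum)
  have "((\<lambda>p. A ** mscale (t ^ ?w p) (?M p)
      + mscale t (mscale (of_nat (?w p) * t ^ (?w p - 1)) (?M p))) has_sum
      A ** ?G + mscale t D) UNIV"
    using H6_has_sum[OF C t(1), of "y * t" A]
    by (intro has_sum_add has_sum_bounded_linear[OF bounded_linear_mult_left]
        has_sum_bounded_linear[OF bounded_linear_mscale] D) (simp only: monomial)
  moreover have "A ** mscale (t ^ ?w p) (?M p)
      + mscale t (mscale (of_nat (?w p) * t ^ (?w p - 1)) (?M p)) =
      A ** mscale ((t ^ 2) ^ fst p * (y * t) ^ snd p) (hcoeff (A + mat 1) C p)" for p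
  proof -
    have "mscale t (mscale (of_nat (?w p) * t ^ (?w p - 1)) (?M p)) =
        mscale (of_nat (?w p)) (mscale (t ^ ?w p) (?M p))"
      by (rule mscale_euler)
    then have "A ** mscale (t ^ ?w p) (?M p)
        + mscale t (mscale (of_nat (?w p) * t ^ (?w p - 1)) (?M p)) =
        (A + mat (of_nat (?w p))) ** mscale (t ^ ?w p) (?M p)"
      by (simp only: matrix_add_rdistrib mat_mult)
    then show ?thesis
      by (simp only: monomial mscale_mult_right hcoeff_raise)
  qed
  moreover have "((\<lambda>p. A ** mscale ((t ^ 2) ^ fst p * (y * t) ^ snd p) (hcoeff (A + mat 1) C p))
      has_sum A ** H6 (A + mat 1) C (t ^ 2) (y * t)) UNIV"
    by (intro has_sum_bounded_linear[OF bounded_linear_mult_left] H6_has_sum C t)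
  ultimately have eq: "A ** ?G + mscale t D = A ** H6 (A + mat 1) C (t ^ 2) (y * t)"
    by (simp only: has_sum_unique)
  have "has_mderiv (\<lambda>s. mpowr s A ** H6 A C (s ^ 2) (y * s))
      (mscale (1 / t) (A ** mpowr t A) ** ?G + mpowr t A ** D) t"
    by (rule has_mderiv_mult[OF has_mderiv_mpowr[OF t(2)] dG])
  moreover have "mscale (1 / t) (A ** mpowr t A) ** ?G + mpowr t A ** D =
      mscale (1 / t) (mpowr t A ** (A ** ?G + mscale t D))"
    using t0 unfolding mpowr_commute[of A A, OF refl]
    by (simp add: matrix_add_ldistrib mscale_add_right mscale_mult_left mscale_mult_right
        mscale_mscale matrix_mul_assoc)
  ultimately show ?thesis by (simp only: eq)
qed

text \<open>
  Along the curve \<open>(t, t y)\<close> the degree of the monomial is \<open>k = m+n\<close>. With \<open>G\<close> the series and \<open>P = t\<^sup>B\<close>,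
  \<open>t (G P)' = (G B + t G') P\<close>; the power stands on the right, next to the inverse Pochhammer symbols with
  which it commutes, so \<open>B + k I\<close> meets the inverse of \<open>(B + I)\<^sub>k\<close> and turns it into
  \<open>B\<close> times the inverse of \<open>(B)\<^sub>k\<close>. The lemma is stated for \<open>B = C - I\<close>, which spares subtractions in the parameters.
\<close>

lemma has_mderiv_H6_mult_mpowr:
  assumes B: "\<And>k::nat. invertible (B + mat (of_nat k))"
    and t: "cmod t < 1/4" "t \<notin> \<real>\<^sub>\<le>\<^sub>0"
  shows "has_mderiv (\<lambda>s. H6 A (B + mat 1) s (s * y) ** mpowr s B)
    (H6 A B t (t * y) ** mpowr t (B - mat 1) ** B) t"
proof -
  let ?w = "\<lambda>p :: nat \<times> nat. fst p + snd p"
  let ?M = "\<lambda>p. mscale (y ^ snd p) (hcoeff A (B + mat 1) p)"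
  have t0: "t \<noteq> 0" using t(2) by auto
  have C: "invertible (B + mat 1 + mat (of_nat k))" for k :: nat
    using invertible_shift[OF B, of 1 k] by simp
  have monomial: "mscale (s ^ ?w p) (?M p) = mscale (s ^ fst p * (s * y) ^ snd p) (hcoeff A (B + mat 1) p)" for s p
    by (simp add: mscale_mscale power_add power_mult_distrib mult_ac)
  have "(\<lambda>p. \<rho> ^ ?w p * norm (?M p)) summable_on UNIV" if "0 \<le> \<rho>" "\<rho> < 1/4" for \<rho>
    using hcoeff_summable[OF C that, of "cmod y * \<rho>" A] that
    by (simp add: norm_mscale norm_power power_add power_mult_distrib mult_ac)
  from has_mderiv_monomial_family[of "1/4" ?w ?M t, OF this t(1)]
  obtain D where D: "((\<lambda>p. mscale (of_nat (?w p) * t ^ (?w p - 1)) (?M p)) has_sum D) UNIV"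
    and deriv: "has_mderiv (\<lambda>s. \<Sum>\<^sub>\<infinity>p. mscale (s ^ ?w p) (?M p)) D t"
    by blast
  let ?G = "H6 A (B + mat 1) t (t * y)"
  have dG: "has_mderiv (\<lambda>s. H6 A (B + mat 1) s (s * y)) D t"
    using deriv by (simp only: monomial H6_eq_infsum)
  have "((\<lambda>p. mscale (t ^ ?w p) (?M p) ** B
      + mscale t (mscale (of_nat (?w p) * t ^ (?w p - 1)) (?M p))) has_sum
      ?G ** B + mscale t D) UNIV"
    using H6_has_sum[OF C t(1), of "t * y" A]
    by (intro has_sum_add has_sum_bounded_linear[OF bounded_linear_mult_right]
        has_sum_bounded_linear[OF bounded_linear_mscale] D) (simp only: monomial)
  moreover have "mscale (t ^ ?w p) (?M p) ** B
      + mscale t (mscale (of_nat (?w p) * t ^ (?w p - 1)) (?M p)) =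
      mscale (t ^ fst p * (t * y) ^ snd p) (hcoeff A B p) ** B" for p
  proof -
    have "mscale t (mscale (of_nat (?w p) * t ^ (?w p - 1)) (?M p)) =
        mscale (of_nat (?w p)) (mscale (t ^ ?w p) (?M p))"
      by (rule mscale_euler)
    then have "mscale (t ^ ?w p) (?M p) ** B
        + mscale t (mscale (of_nat (?w p) * t ^ (?w p - 1)) (?M p)) =
        mscale (t ^ ?w p) (?M p) ** (B + mat (of_nat (?w p)))"
      by (simp only: matrix_add_ldistrib mult_mat)
    then show ?thesis
      by (simp only: monomial mscale_mult_left hcoeff_lower[OF B])
  qed
  moreover have "((\<lambda>p. mscale (t ^ fst p * (t * y) ^ snd p) (hcoeff A B p) ** B)
      has_sum H6 A B t (t * y) ** B) UNIV"
    by (intro has_sum_bounded_linear[OF bounded_linear_mult_right] H6_has_sum B t)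
  ultimately have eq: "?G ** B + mscale t D = H6 A B t (t * y) ** B"
    by (simp only: has_sum_unique)
  have "has_mderiv (\<lambda>s. H6 A (B + mat 1) s (s * y) ** mpowr s B)
      (D ** mpowr t B + ?G ** mscale (1 / t) (B ** mpowr t B)) t"
    by (rule has_mderiv_mult[OF dG has_mderiv_mpowr[OF t(2)]])
  moreover have "D ** mpowr t B + ?G ** mscale (1 / t) (B ** mpowr t B) =
      mscale (1 / t) ((?G ** B + mscale t D) ** mpowr t B)"
    using t0
    by (simp add: matrix_add_rdistrib mscale_add_right mscale_mult_left mscale_mult_right
        mscale_mscale matrix_mul_assoc)
  moreover have "mscale (1 / t) (H6 A B t (t * y) ** B ** mpowr t B) =
      H6 A B t (t * y) ** mpowr t (B - mat 1) ** B"
    using mpowr_commute[of B B t, OF refl]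
    by (simp add: mpowr_diff_one[OF t0] mscale_mult_left mscale_mult_right matrix_mul_assoc[symmetric])
  ultimately show ?thesis by (simp only: eq)
qed

section \<open>Iterated derivatives\<close>

text \<open>
  The values of \<^const>\<open>mderiv\<close> are only controlled on \<open>S\<close>. Since \<open>S\<close> is open, the agreement of the
  \<open>n\<close>-th iterate with \<open>G n\<close> on \<open>S\<close> suffices to differentiate once more. The factor \<open>\<phi>\<close> covers
  both \<open>d/dx\<close> and \<open>x\<^sup>2 d/dx\<close>.
\<close>

lemma funpow_mderiv_eq:
  fixes G E :: "nat \<Rightarrow> complex \<Rightarrow> complex^'d^'d"
  assumes op: "\<And>F t. op F t = mscale (\<phi> t) (mderiv F t)"
    and S: "open S" "t \<in> S"
    and deriv: "\<And>k s. k < n \<Longrightarrow> s \<in> S \<Longrightarrow> has_mderiv (G k) (E k s) s"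
    and step: "\<And>k s. k < n \<Longrightarrow> s \<in> S \<Longrightarrow> mscale (\<phi> s) (E k s) = G (Suc k) s"
  shows "(op ^^ n) (G 0) t = G n t"
  using S(2) deriv step
proof (induction n arbitrary: t)
  case (Suc n)
  have eq: "G n s = (op ^^ n) (G 0) s" if "s \<in> S" for s
    using Suc.IH[OF that] Suc.prems(2,3) by simp
  have "has_mderiv ((op ^^ n) (G 0)) (E n t) t"
    by (rule has_mderiv_transform_open[OF Suc.prems(2) S(1) Suc.prems(1) eq]) (use Suc.prems in auto)
  from mderiv_eqI[OF this] Suc.prems(1,3) show ?case
    by (simp only: funpow.simps(2) comp_apply op[of "(op ^^ n) (G 0)" t] lessI)
qed simp

text \<open>
  The operator \<open>d/dx\<close> in the form required by the preceding lemma, with \<open>\<phi> =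
  1\<close>.
\<close>

lemma mscale_one_mderiv: "mderiv F t = mscale 1 (mderiv F t)"
  by simp

lemma H6_derivatives_x:
  assumes C: "\<And>k::nat. invertible (C + mat (of_nat k))" and x: "cmod x < 1/4"
  shows "mholomorphic_on (\<lambda>t. H6 A C t y) {t. cmod t < 1/4}"
    and "(mderiv ^^ r) (\<lambda>t. H6 A C t y) x =
      mpochhammer A (2 * r) ** H6 (A + mat (of_nat (2 * r))) (C + mat (of_nat r)) x y
        ** matrix_inv (mpochhammer C r)"
proof -
  have "open {t. cmod t < 1/4}" by (intro open_Collect_less continuous_intros)
  then show "mholomorphic_on (\<lambda>t. H6 A C t y) {t. cmod t < 1/4}"
    by (rule mholomorphic_onI) (rule has_mderiv_H6_x[OF C], simp)
  define G where "G k t = mpochhammer A (2 * k)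
      ** H6 (A + mat (of_nat (2 * k))) (C + mat (of_nat k)) t y ** matrix_inv (mpochhammer C k)"
    for k t
  have deriv: "has_mderiv (G k) (G (Suc k) t) t" if t: "t \<in> {t. cmod t < 1/4}" for k t
  proof -
    let ?A = "A + mat (of_nat (2 * k))" and ?C = "C + mat (of_nat k)"
    let ?H = "H6 (?A + mat 2) (?C + mat 1) t y"
    have "has_mderiv (G k) (mpochhammer A (2 * k) ** (?A ** (?A + mat 1) ** ?H ** matrix_inv ?C)
        ** matrix_inv (mpochhammer C k)) t"
      unfolding G_def using t
      by (intro has_mderiv_mult_const_left has_mderiv_mult_const_right has_mderiv_H6_x
          invertible_shift[OF C]) simp
    then have "has_mderiv (G k) (mpochhammer A (2 * k) ** (?A ** (?A + mat 1)) ** ?H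
        ** (matrix_inv ?C ** matrix_inv (mpochhammer C k))) t"
      by (simp only: matrix_mul_assoc)
    moreover have "matrix_inv ?C ** matrix_inv (mpochhammer C k) = matrix_inv (mpochhammer C (Suc k))"
      using matrix_inv_mult[OF invertible_mpochhammer[OF C] C] by simp
    moreover have "mpochhammer A (2 * k) ** (?A ** (?A + mat 1)) = mpochhammer A (2 * Suc k)"
    proof -
      have "?A + mat 1 = A + mat (of_nat (Suc (2 * k)))"
        by (subst add_mat_mat) (simp add: add.commute)
      then have "mpochhammer A (2 * k) ** (?A ** (?A + mat 1)) = mpochhammer A (Suc (Suc (2 * k)))"
        by (simp only: mpochhammer.simps matrix_mul_assoc)
      then show ?thesis by simp
    qed
    moreover have "?A + mat 2 = A + mat (of_nat (2 * Suc k))" "?C + mat 1 = C + mat (of_nat (Suc k))"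
      by (simp_all add: mat_add add.assoc add.commute)
    ultimately show ?thesis
      by (simp only: G_def)
  qed
  have G0: "G 0 = (\<lambda>t. H6 A C t y)"
    by (simp add: G_def fun_eq_iff matrix_inv_one)
  have "(mderiv ^^ r) (G 0) x = G r x"
    by (rule funpow_mderiv_eq[where G = G and \<phi> = "\<lambda>_. 1" and S = "{t. cmod t < 1/4}", OF mscale_one_mderiv
        \<open>open _\<close> _ deriv]) (use x in simp_all)
  then show "(mderiv ^^ r) (\<lambda>t. H6 A C t y) x =
      mpochhammer A (2 * r) ** H6 (A + mat (of_nat (2 * r))) (C + mat (of_nat r)) x y
        ** matrix_inv (mpochhammer C r)"
    by (simp only: G0) (simp only: G_def)
qed

lemma H6_derivatives_y:
  assumes C: "\<And>k::nat. invertible (C + mat (of_nat k))" and x: "cmod x < 1/4"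
  shows "mholomorphic_on (\<lambda>t. H6 A C x t) UNIV"
    and "(mderiv ^^ r) (\<lambda>t. H6 A C x t) y =
      mpochhammer A r ** H6 (A + mat (of_nat r)) (C + mat (of_nat r)) x y
        ** matrix_inv (mpochhammer C r)"
proof -
  show "mholomorphic_on (\<lambda>t. H6 A C x t) UNIV"
    by (rule mholomorphic_onI[OF open_UNIV has_mderiv_H6_y[OF C x]])
  define G where "G k t = mpochhammer A k
      ** H6 (A + mat (of_nat k)) (C + mat (of_nat k)) x t ** matrix_inv (mpochhammer C k)"
    for k t
  have deriv: "has_mderiv (G k) (G (Suc k) t) t" for k t
  proof -
    let ?A = "A + mat (of_nat k)" and ?C = "C + mat (of_nat k)"
    let ?H = "H6 (?A + mat 1) (?C + mat 1) x t"
    have "has_mderiv (G k) (mpochhammer A k ** (?A ** ?H ** matrix_inv ?C)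
        ** matrix_inv (mpochhammer C k)) t"
      unfolding G_def
      by (intro has_mderiv_mult_const_left has_mderiv_mult_const_right has_mderiv_H6_y
          invertible_shift[OF C] x)
    then have "has_mderiv (G k) (mpochhammer A k ** ?A ** ?H
        ** (matrix_inv ?C ** matrix_inv (mpochhammer C k))) t"
      by (simp only: matrix_mul_assoc)
    moreover have "matrix_inv ?C ** matrix_inv (mpochhammer C k) = matrix_inv (mpochhammer C (Suc k))"
      using matrix_inv_mult[OF invertible_mpochhammer[OF C] C] by simp
    moreover have "?A + mat 1 = A + mat (of_nat (Suc k))" "?C + mat 1 = C + mat (of_nat (Suc k))"
      by (simp_all add: mat_add add.assoc add.commute)
    ultimately show ?thesis
      by (simp only: G_def mpochhammer.simps(2))
  qed
  have G0: "G 0 = (\<lambda>t. H6 A C x t)"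
    by (simp add: G_def fun_eq_iff matrix_inv_one)
  have "(mderiv ^^ r) (G 0) y = G r y"
    by (rule funpow_mderiv_eq[where G = G and \<phi> = "\<lambda>_. 1" and S = UNIV, OF mscale_one_mderiv
        open_UNIV _ deriv]) simp_all
  then show "(mderiv ^^ r) (\<lambda>t. H6 A C x t) y =
      mpochhammer A r ** H6 (A + mat (of_nat r)) (C + mat (of_nat r)) x y
        ** matrix_inv (mpochhammer C r)"
    by (simp only: G0) (simp only: G_def)
qed

lemma open_slit_square_disc: "open {t. cmod (t ^ 2) < a \<and> t \<notin> \<real>\<^sub>\<le>\<^sub>0}"
  by (intro open_Collect_conj open_Collect_less continuous_intros)
    (simp add: open_Compl[OF closed_nonpos_Reals_complex, unfolded Compl_eq])

text \<open>
  One application of \<open>t\<^sup>2 d/dt\<close> to \<open>t\<^sup>A H\<^sub>6(A; C)\<close> yields \<open>t\<^bsup>A+I\<^esup> A H\<^sub>6(A + I; C)\<close>: a constant matrix \<open>A\<close>,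
  which can be moved to the left of the power, times an expression of the original form with \<open>A + I\<close> for \<open>A\<close>.
  The constants accumulate to \<open>(A)\<^sub>r\<close>.
\<close>

lemma H6_derivatives_mpowr_left:
  assumes C: "\<And>k::nat. invertible (C + mat (of_nat k))"
    and x: "cmod (x ^ 2) < 1/4" "x \<notin> \<real>\<^sub>\<le>\<^sub>0"
  shows "mholomorphic_on (\<lambda>t. mpowr t A ** H6 A C (t ^ 2) (y * t))
      {t. cmod (t ^ 2) < 1/4 \<and> t \<notin> \<real>\<^sub>\<le>\<^sub>0}"
    and "(x2_mderiv ^^ r) (\<lambda>t. mpowr t A ** H6 A C (t ^ 2) (y * t)) x =
      mpowr x (A + mat (of_nat r)) ** mpochhammer A r ** H6 (A + mat (of_nat r)) C (x ^ 2) (y * x)"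
proof -
  let ?S = "{t. cmod (t ^ 2) < 1/4 \<and> t \<notin> \<real>\<^sub>\<le>\<^sub>0}"
  show "mholomorphic_on (\<lambda>t. mpowr t A ** H6 A C (t ^ 2) (y * t)) ?S"
    by (rule mholomorphic_onI[OF open_slit_square_disc has_mderiv_mpowr_mult_H6[OF C]]) auto
  have comm: "mpowr t (A + mat c) ** mpochhammer A k = mpochhammer A k ** mpowr t (A + mat c)" for t c k
  proof -
    have "A ** mpowr t (A + mat c) = mpowr t (A + mat c) ** A"
      by (rule mpowr_commute[OF commute_add_mat[OF refl]])
    then show ?thesis by (rule commute_mpochhammer[OF sym])
  qed
  define G where "G k t = mpowr t (A + mat (of_nat k)) ** mpochhammer A k
      ** H6 (A + mat (of_nat k)) C (t ^ 2) (y * t)" for k t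
  define E where "E k t = mpochhammer A k ** mscale (1 / t) (mpowr t (A + mat (of_nat k)) **
      ((A + mat (of_nat k)) ** H6 (A + mat (of_nat (Suc k))) C (t ^ 2) (y * t)))" for k t
  have G_alt: "G k = (\<lambda>t. mpochhammer A k **
      (mpowr t (A + mat (of_nat k)) ** H6 (A + mat (of_nat k)) C (t ^ 2) (y * t)))" for k
    by (intro ext) (simp only: G_def comm matrix_mul_assoc)
  have Suc: "A + mat (of_nat k) + mat 1 = A + mat (of_nat (Suc k))" for k
    by (simp add: mat_add add.assoc add.commute)
  have deriv: "has_mderiv (G k) (E k t) t" if "t \<in> ?S" for k t
    unfolding G_alt E_def Suc[symmetric] using that
    by (intro has_mderiv_mult_const_left has_mderiv_mpowr_mult_H6[OF C]) auto
  have step: "mscale (t ^ 2) (E k t) = G (Suc k) t" if "t \<in> ?S" for k t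
  proof -
    let ?A = "A + mat (of_nat k)"
    have t0: "t \<noteq> 0" using that by auto
    have "mscale (t ^ 2) (E k t) = mpochhammer A k ** (mpowr t (?A + mat 1) **
        (?A ** H6 (?A + mat 1) C (t ^ 2) (y * t)))"
      using t0 unfolding E_def Suc[symmetric] mpowr_add_one[OF t0]
      by (simp add: mscale_mult_left mscale_mult_right mscale_mscale power2_eq_square)
    also have "\<dots> = mpochhammer A k ** (?A ** mpowr t (?A + mat 1)) ** H6 (?A + mat 1) C (t ^ 2) (y * t)"
      using mpowr_commute[OF commute_add_mat[OF refl, of ?A 1], of t]
      by (simp add: matrix_mul_assoc)
    also have "\<dots> = mpochhammer A (Suc k) ** mpowr t (?A + mat 1) ** H6 (?A + mat 1) C (t ^ 2) (y * t)"
      by (simp add: matrix_mul_assoc)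
    finally show ?thesis
      unfolding G_def Suc comm .
  qed
  have G0: "G 0 = (\<lambda>t. mpowr t A ** H6 A C (t ^ 2) (y * t))"
    by (simp add: G_def fun_eq_iff)
  have "(x2_mderiv ^^ r) (G 0) x = G r x"
    by (rule funpow_mderiv_eq[where G = G and E = E and \<phi> = "\<lambda>t. t ^ 2" and S = ?S, OF x2_mderiv_def
        open_slit_square_disc _ deriv step]) (use x in auto)
  then show "(x2_mderiv ^^ r) (\<lambda>t. mpowr t A ** H6 A C (t ^ 2) (y * t)) x =
      mpowr x (A + mat (of_nat r)) ** mpochhammer A r ** H6 (A + mat (of_nat r)) C (x ^ 2) (y * x)"
    by (simp only: G0) (simp only: G_def)
qed

lemma open_slit_disc: "open {t. cmod t < a \<and> t \<notin> \<real>\<^sub>\<le>\<^sub>0}"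
  by (intro open_Collect_conj open_Collect_less continuous_intros)
    (simp add: open_Compl[OF closed_nonpos_Reals_complex, unfolded Compl_eq])

text \<open>
  Each derivative lowers the denominator parameter by \<open>I\<close> and produces the factor
  \<open>C - (k + 1) I = - ((I - C) + k I)\<close> on the right; together these form \<open>(-1)\<^sup>r (I - C)\<^sub>r\<close>. The assumption on
  \<open>C - r I\<close> makes all intermediate parameters \<open>C - k I\<close> with \<open>k \<le> r\<close> admissible.
\<close>

lemma H6_derivatives_mpowr_right:
  assumes C: "\<And>k::nat. invertible (C + mat (of_nat k))"
    and x: "cmod x < 1/4" "x \<notin> \<real>\<^sub>\<le>\<^sub>0" and "r > 0"
    and Cr: "\<And>k::nat. invertible (C - mat (of_nat r) + mat (of_nat k))"
  shows "mholomorphic_on (\<lambda>t. H6 A C t (t * y) ** mpowr t (C - mat 1))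
      {t. cmod t < 1/4 \<and> t \<notin> \<real>\<^sub>\<le>\<^sub>0}"
    and "(mderiv ^^ r) (\<lambda>t. H6 A C t (t * y) ** mpowr t (C - mat 1)) x =
      mscale ((-1) ^ r) (H6 A (C - mat (of_nat r)) x (x * y) ** mpowr x (C - mat (of_nat (r + 1)))
        ** mpochhammer (mat 1 - C) r)"
proof -
  let ?S = "{t. cmod t < 1/4 \<and> t \<notin> \<real>\<^sub>\<le>\<^sub>0}"
  define G where "G k t = mscale ((-1) ^ k) (H6 A (C - mat (of_nat k)) t (t * y)
      ** mpowr t (C - mat (of_nat (k + 1))) ** mpochhammer (mat 1 - C) k)" for k t
  have deriv: "has_mderiv (G k) (G (Suc k) t) t" if k: "k < r" and t: "t \<in> ?S" for k t
  proof -
    let ?B = "C - mat (of_nat (k + 1))" and ?P = "mpochhammer (mat 1 - C) k"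
    have B1: "?B + mat 1 = C - mat (of_nat k)" and B2: "?B - mat 1 = C - mat (of_nat (Suc k + 1))"
      by (simp_all add: vec_eq_iff mat_def)
    have "invertible (?B + mat (of_nat j))" for j
    proof -
      have "?B + mat (of_nat j) = C - mat (of_nat r) + mat (of_nat (j + (r - (k + 1))))"
        using k by (simp add: vec_eq_iff mat_def of_nat_diff)
      then show ?thesis by (simp only: Cr)
    qed
    from has_mderiv_H6_mult_mpowr[OF this, of t A y] t
    have "has_mderiv (\<lambda>s. H6 A (C - mat (of_nat k)) s (s * y) ** mpowr s ?B)
        (H6 A ?B t (t * y) ** mpowr t (C - mat (of_nat (Suc k + 1))) ** ?B) t"
      unfolding B1 B2 by auto
    then have "has_mderiv (G k)
        (mscale ((-1) ^ k) (H6 A ?B t (t * y) ** mpowr t (C - mat (of_nat (Suc k + 1))) ** ?B ** ?P)) t"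
      unfolding G_def by (intro has_mderiv_cmult has_mderiv_mult_const_right)
    moreover have "?B ** ?P = mscale (-1) (mpochhammer (mat 1 - C) (Suc k))"
    proof -
      have "(mat 1 - C + mat (of_nat k)) ** ?P = ?P ** (mat 1 - C + mat (of_nat k))"
        by (rule commute_mpochhammer[OF commute_add_mat[OF refl, symmetric]])
      moreover have "?B = mscale (-1) (mat 1 - C + mat (of_nat k))"
        by (simp add: vec_eq_iff mat_def)
      ultimately show ?thesis by (simp add: mscale_mult_left)
    qed
    ultimately show ?thesis
      by (simp add: G_def mscale_mscale mscale_mult_right matrix_mul_assoc[symmetric]
          del: mpochhammer.simps of_nat_Suc of_nat_add)
  qed
  have G0: "G 0 = (\<lambda>t. H6 A C t (t * y) ** mpowr t (C - mat 1))"
    by (simp add: G_def fun_eq_iff)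
  show "mholomorphic_on (\<lambda>t. H6 A C t (t * y) ** mpowr t (C - mat 1)) ?S"
    using mholomorphic_onI[OF open_slit_disc deriv[OF \<open>r > 0\<close>]] unfolding G0 .
  have "(mderiv ^^ r) (G 0) x = G r x"
    by (rule funpow_mderiv_eq[where G = G and \<phi> = "\<lambda>_. 1" and S = ?S, OF mscale_one_mderiv
        open_slit_disc _ deriv]) (use x in simp_all)
  then show "(mderiv ^^ r) (\<lambda>t. H6 A C t (t * y) ** mpowr t (C - mat 1)) x =
      mscale ((-1) ^ r) (H6 A (C - mat (of_nat r)) x (x * y) ** mpowr x (C - mat (of_nat (r + 1)))
        ** mpochhammer (mat 1 - C) r)"
    by (simp only: G0) (simp only: G_def)
qed

theorem theorem4p18:
  fixes A C :: "complex ^ 'd ^ 'd" and x y :: complex and r :: nat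
  assumes C_inv: "\<And>k::nat. invertible (C + mat (of_nat k))"
    and r_pos: "r > 0"
  shows
    "(cmod x < 1/4 \<longrightarrow>
        mholomorphic_on (\<lambda>t. H6 A C t y) {t. cmod t < 1/4} \<and>
        (mderiv ^^ r) (\<lambda>t. H6 A C t y) x =
          mpochhammer A (2 * r) ** H6 (A + mat (of_nat (2 * r))) (C + mat (of_nat r)) x y
            ** matrix_inv (mpochhammer C r))
   \<and> (cmod x < 1/4 \<longrightarrow>
        mholomorphic_on (\<lambda>t. H6 A C x t) UNIV \<and>
        (mderiv ^^ r) (\<lambda>t. H6 A C x t) y =
          mpochhammer A r ** H6 (A + mat (of_nat r)) (C + mat (of_nat r)) x y
            ** matrix_inv (mpochhammer C r))
   \<and> (cmod (x ^ 2) < 1/4 \<and> x \<notin> \<real>\<^sub>\<le>\<^sub>0 \<longrightarrow>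
        mholomorphic_on (\<lambda>t. mpowr t A ** H6 A C (t ^ 2) (y * t))
          {t. cmod (t ^ 2) < 1/4 \<and> t \<notin> \<real>\<^sub>\<le>\<^sub>0} \<and>
        (x2_mderiv ^^ r) (\<lambda>t. mpowr t A ** H6 A C (t ^ 2) (y * t)) x =
          mpowr x (A + mat (of_nat r)) ** mpochhammer A r
            ** H6 (A + mat (of_nat r)) C (x ^ 2) (y * x))
   \<and> (cmod x < 1/4 \<and> x \<notin> \<real>\<^sub>\<le>\<^sub>0 \<and>
        (\<forall>k::nat. invertible (C - mat (of_nat r) + mat (of_nat k))) \<longrightarrow>
        mholomorphic_on (\<lambda>t. H6 A C t (t * y) ** mpowr t (C - mat 1))
          {t. cmod t < 1/4 \<and> t \<notin> \<real>\<^sub>\<le>\<^sub>0} \<and>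
        (mderiv ^^ r) (\<lambda>t. H6 A C t (t * y) ** mpowr t (C - mat 1)) x =
          mscale ((-1) ^ r)
            (H6 A (C - mat (of_nat r)) x (x * y) ** mpowr x (C - mat (of_nat (r + 1)))
              ** mpochhammer (mat 1 - C) r))"
  using H6_derivatives_x[OF C_inv, of x] H6_derivatives_y[OF C_inv, of x]
    H6_derivatives_mpowr_left[OF C_inv, of x]
    H6_derivatives_mpowr_right[OF C_inv, of x r, OF _ _ r_pos]
  by (intro conjI impI) blast+

end
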